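(* Let $H$ be a complex Hilbert space with $\dim H\geq 2$ and $B(H)^{++}$ the set of positive definite (positive semidefinite and invertible) bounded linear operators on $H$. Let $\sigma$ be a symmetric Kubo–Ando mean with representing operator monotone function $f$. Assume that there exists a continuous strictly increasing surjective function $g:]0,\infty[\to]0,\infty[$ such that the operation $A\diamond B=g(A\sigma B)$, $A,B\in B(H)^{++}$, satisfies $$(A\diamond I)\diamond B=A\diamond(I\diamond B),\quad A,B\in B(H)^{++}.$$ Then either $g(f(t))=t$ for all $t>0$ (so that $A\diamond I=I\diamond A=A$ for all $A\in B(H)^{++}$), or one of the following holds: (a) there is a positive scalar $c\neq 1$ such that $f(c^2t)=cf(t)$ for all $t>0$; (b) $\sigma$ is the arithmetic mean; (c) $\sigma$ is the harmonic mean.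
   Context: A Kubo–Ando mean $\sigma$ is determined by an operator monotone function $f:]0,\infty[\to]0,\infty[$ with $f(1)=1$ (its representing function) via $A\sigma B=A^{1/2}f(A^{-1/2}BA^{-1/2})A^{1/2}$ for $A,B\in B(H)^{++}$. It is symmetric if $tf(1/t)=f(t)$ for $t>0$ (equivalently $A\sigma B=B\sigma A$). The arithmetic mean has $f(t)=(1+t)/2$, i.e. $A\sigma B=(A+B)/2$; the harmonic mean has $f(t)=2t/(1+t)$, i.e. $A\sigma B=2(A^{-1}+B^{-1})^{-1}$. $g(\cdot)$ applied to an operator is defined by continuous functional calculus. *)

theory Defs
  imports Complex_Main "Jordan_Normal_Form.Schur_Decomposition"
begin

class chilbert = real_normed_vector + complete_space +
  fixes scaleC :: "complex \<Rightarrow> 'a \<Rightarrow> 'a" (infixr \<open>*\<^sub>C\<close> 75)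
    and cinner :: "'a \<Rightarrow> 'a \<Rightarrow> complex"
  assumes scaleC_add_right: "a *\<^sub>C (x + y) = a *\<^sub>C x + a *\<^sub>C y"
    and scaleC_add_left: "(a + b) *\<^sub>C x = a *\<^sub>C x + b *\<^sub>C x"
    and scaleC_scaleC: "a *\<^sub>C (b *\<^sub>C x) = (a * b) *\<^sub>C x"
    and scaleC_one: "1 *\<^sub>C x = x"
    and scaleR_scaleC: "scaleR r x = complex_of_real r *\<^sub>C x"
    and cinner_add_left: "cinner (x + y) z = cinner x z + cinner y z"
    and cinner_scaleC_left: "cinner (a *\<^sub>C x) y = cnj a * cinner x y"
    and cinner_commute: "cinner x y = cnj (cinner y x)"
    and cinner_ge_zero: "0 \<le> Re (cinner x x)"
    and cinner_eq_zero_iff: "cinner x x = 0 \<longleftrightarrow> x = 0"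
    and norm_eq_sqrt_cinner: "norm x = sqrt (Re (cinner x x))"

definition bounded_op :: "('a::chilbert \<Rightarrow> 'a) \<Rightarrow> bool" where
  "bounded_op A \<longleftrightarrow> (\<forall>x y. A (x + y) = A x + A y) \<and> (\<forall>c x. A (c *\<^sub>C x) = c *\<^sub>C A x)
     \<and> (\<exists>K. \<forall>x. norm (A x) \<le> norm x * K)"

definition invertible_op :: "('a::chilbert \<Rightarrow> 'a) \<Rightarrow> bool" where
  "invertible_op A \<longleftrightarrow> bounded_op A \<and> (\<exists>B. bounded_op B \<and> A \<circ> B = id \<and> B \<circ> A = id)"

definition positive_op :: "('a::chilbert \<Rightarrow> 'a) \<Rightarrow> bool" where
  "positive_op A \<longleftrightarrow> bounded_op A \<and> (\<forall>x. Im (cinner x (A x)) = 0 \<and> 0 \<le> Re (cinner x (A x)))"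

definition pos_def_op :: "('a::chilbert \<Rightarrow> 'a) \<Rightarrow> bool" where
  "pos_def_op A \<longleftrightarrow> positive_op A \<and> invertible_op A"

definition opnorm :: "('a::chilbert \<Rightarrow> 'a) \<Rightarrow> real" where
  "opnorm A = Sup {norm (A x) | x. norm x \<le> 1}"

text \<open>Real spectrum (enough for self-adjoint operators).\<close>
definition real_spectrum :: "('a::chilbert \<Rightarrow> 'a) \<Rightarrow> real set" where
  "real_spectrum A = {s. \<not> invertible_op (\<lambda>x. A x - complex_of_real s *\<^sub>C x)}"

definition poly_op :: "nat \<Rightarrow> (nat \<Rightarrow> real) \<Rightarrow> ('a::chilbert \<Rightarrow> 'a) \<Rightarrow> ('a \<Rightarrow> 'a)" where
  "poly_op N c A = (\<lambda>x. \<Sum>i\<le>N. complex_of_real (c i) *\<^sub>C (A ^^ i) x)"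

text \<open>Continuous functional calculus: fc g A is the operator-norm limit of
  p(A) for real polynomials p converging uniformly to g on the
  spectrum of A.\<close>
definition fc :: "(real \<Rightarrow> real) \<Rightarrow> ('a::chilbert \<Rightarrow> 'a) \<Rightarrow> ('a \<Rightarrow> 'a)" where
  "fc g A = (THE B. bounded_op B \<and>
     (\<forall>\<epsilon>>0. \<exists>\<delta>>0. \<forall>N c. (\<forall>t\<in>real_spectrum A. \<bar>(\<Sum>i\<le>N. c i * t ^ i) - g t\<bar> < \<delta>)
        \<longrightarrow> opnorm (\<lambda>x. poly_op N c A x - B x) < \<epsilon>))"

definition km_mean :: "(real \<Rightarrow> real) \<Rightarrow> ('a::chilbert \<Rightarrow> 'a) \<Rightarrow> ('a \<Rightarrow> 'a) \<Rightarrow> ('a \<Rightarrow> 'a)" where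
  "km_mean f A B =
     fc sqrt A \<circ> fc f (fc (\<lambda>t. inverse (sqrt t)) A \<circ> B \<circ> fc (\<lambda>t. inverse (sqrt t)) A) \<circ> fc sqrt A"

definition herm_mat :: "nat \<Rightarrow> complex mat \<Rightarrow> bool" where
  "herm_mat n A \<longleftrightarrow> A \<in> carrier_mat n n \<and> mat_adjoint A = A"

definition pd_mat :: "nat \<Rightarrow> complex mat \<Rightarrow> bool" where
  "pd_mat n A \<longleftrightarrow> herm_mat n A \<and>
     (\<forall>v \<in> carrier_vec n. v \<noteq> 0\<^sub>v n \<longrightarrow> 0 < Re ((A *\<^sub>v v) \<bullet>c v))"

definition loewner_le :: "nat \<Rightarrow> complex mat \<Rightarrow> complex mat \<Rightarrow> bool" where
  "loewner_le n A B \<longleftrightarrow> herm_mat n A \<and> herm_mat n B \<and>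
     (\<forall>v \<in> carrier_vec n. 0 \<le> Re (((B - A) *\<^sub>v v) \<bullet>c v))"

definition unitary_mat :: "nat \<Rightarrow> complex mat \<Rightarrow> bool" where
  "unitary_mat n U \<longleftrightarrow> U \<in> carrier_mat n n \<and> U * mat_adjoint U = 1\<^sub>m n"

definition diag_of :: "nat \<Rightarrow> (nat \<Rightarrow> real) \<Rightarrow> complex mat" where
  "diag_of n d = mat n n (\<lambda>(i, j). if i = j then complex_of_real (d i) else 0)"

definition mat_fc :: "nat \<Rightarrow> (real \<Rightarrow> real) \<Rightarrow> complex mat \<Rightarrow> complex mat" where
  "mat_fc n f A = (SOME B. \<exists>U d. unitary_mat n U \<and> A = U * diag_of n d * mat_adjoint U
      \<and> B = U * diag_of n (\<lambda>i. f (d i)) * mat_adjoint U)"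

definition operator_monotone :: "(real \<Rightarrow> real) \<Rightarrow> bool" where
  "operator_monotone f \<longleftrightarrow> (\<forall>n A B. pd_mat n A \<and> pd_mat n B \<and> loewner_le n A B
      \<longrightarrow> loewner_le n (mat_fc n f A) (mat_fc n f B))"

end

theory Submission
  imports Defs
begin

text \<open>
  Put \<open>h = g \<circ> f\<close>. Since \<open>A \<sigma> I = f(A)\<close> and \<open>g\<close> is injective, the hypothesis says
  \<open>h(A) \<sigma> B = A \<sigma> h(B)\<close>. For a symmetric \<open>2 \<times> 2\<close> matrix \<open>T\<close> with eigenvalues \<open>\<lambda>, \<mu>\<close> one has
  \<open>f(T) = f[\<lambda>, \<mu>] T + const\<close>, where \<open>f[\<lambda>, \<mu>]\<close> is the divided difference. Comparing the off-diagonal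
  entries for diagonal \<open>A = diag(x, y)\<close> and \<open>B = I + \<epsilon> X\<close>, \<open>X\<close> the flip, and letting \<open>\<epsilon> \<rightarrow> 0\<close> yields a
  constant \<open>K > 0\<close> with \<open>K f[d/x, d/y] = f[1/h(x), 1/h(y)]\<close>, \<open>d = h(1)\<close>. With the scalar identity
  \<open>x f(d/x) = h(x) f(1/h(x)) = m(x)\<close> and \<open>k = K/d\<close> this becomes
  \<open>k (m(x) y - m(y) x) (h(y) - h(x)) = (m(x) h(y) - m(y) h(x)) (y - x)\<close>.
  If \<open>k = 1\<close>, then \<open>h(x)/x\<close> is constant. Otherwise the equation determines \<open>m(x)/m(y)\<close>, and the cocycle
  condition at three points factors: the three points are collinear on the graph of \<open>h\<close> or on the graph
  of \<open>x/h(x)\<close>. So one of these functions is affine, and \<open>f\<close> can be read off.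
\<close>

subsection \<open>Bounded operators\<close>

lemma scaleC_zero_left [simp]: "0 *\<^sub>C (x::'a::chilbert) = 0"
  using scaleC_add_left[of 0 0 x] by simp

lemma scaleC_zero_right [simp]: "a *\<^sub>C (0::'a::chilbert) = 0"
  using scaleC_add_right[of a 0 "0::'a"] by simp

lemma scaleC_minus_left: "(- a) *\<^sub>C (x::'a::chilbert) = - (a *\<^sub>C x)"
  using scaleC_add_left[of a "- a" x] by (simp add: eq_neg_iff_add_eq_0 add.commute)

lemma scaleC_minus_right: "a *\<^sub>C (- x::'a::chilbert) = - (a *\<^sub>C x)"
  using scaleC_add_right[of a x "- x"] by (simp add: eq_neg_iff_add_eq_0 add.commute)

lemma scaleC_diff_left: "(a - b) *\<^sub>C (x::'a::chilbert) = a *\<^sub>C x - b *\<^sub>C x"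
  using scaleC_add_left[of a "- b" x] by (simp add: scaleC_minus_left)

lemma scaleC_diff_right: "a *\<^sub>C (x - y::'a::chilbert) = a *\<^sub>C x - a *\<^sub>C y"
  using scaleC_add_right[of a x "- y"] by (simp add: scaleC_minus_right)

lemma scaleC_sum_right: "a *\<^sub>C (\<Sum>i\<in>I. x i :: 'a::chilbert) = (\<Sum>i\<in>I. a *\<^sub>C x i)"
  by (induction I rule: infinite_finite_induct) (auto simp: scaleC_add_right)

lemma scaleC_sum_left: "(\<Sum>i\<in>I. c i) *\<^sub>C (x :: 'a::chilbert) = (\<Sum>i\<in>I. c i *\<^sub>C x)"
  by (induction I rule: infinite_finite_induct) (auto simp: scaleC_add_left)

lemma cinner_add_right: "cinner (x::'a::chilbert) (y + z) = cinner x y + cinner x z"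
  by (metis cinner_add_left cinner_commute complex_cnj_add)

lemma cinner_scaleC_right: "cinner (x::'a::chilbert) (a *\<^sub>C y) = a * cinner x y"
  by (metis cinner_commute cinner_scaleC_left complex_cnj_cnj complex_cnj_mult)

lemma cinner_minus_left: "cinner (- x) (y::'a::chilbert) = - cinner x y"
  using cinner_scaleC_left[of "-1" x y] by (simp add: scaleC_minus_left scaleC_one)

lemma cinner_minus_right: "cinner x (- y::'a::chilbert) = - cinner x y"
  using cinner_scaleC_right[of x "-1" y] by (simp add: scaleC_minus_left scaleC_one)

lemma cinner_diff_left: "cinner (x - y) (z::'a::chilbert) = cinner x z - cinner y z"
  using cinner_add_left[of x "- y" z] by (simp add: cinner_minus_left)

lemma cinner_diff_right: "cinner x (y - z::'a::chilbert) = cinner x y - cinner x z"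
  using cinner_add_right[of x y "- z"] by (simp add: cinner_minus_right)

lemma cinner_self: "cinner x (x::'a::chilbert) = complex_of_real ((norm x)\<^sup>2)"
proof (rule complex_eqI)
  show "Im (cinner x x) = Im (complex_of_real ((norm x)\<^sup>2))"
    using cinner_commute[of x x] by (simp add: complex_eq_iff)
  show "Re (cinner x x) = Re (complex_of_real ((norm x)\<^sup>2))"
    using cinner_ge_zero[of x] by (simp add: norm_eq_sqrt_cinner)
qed

lemma norm_scaleC: "norm (a *\<^sub>C (x::'a::chilbert)) = cmod a * norm x"
proof -
  have "complex_of_real ((norm (a *\<^sub>C x))\<^sup>2) = complex_of_real ((cmod a * norm x)\<^sup>2)"
    unfolding cinner_self[symmetric] power_mult_distrib of_real_mult complex_norm_square
    by (simp add: cinner_scaleC_left cinner_scaleC_right mult_ac)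
  then have "(norm (a *\<^sub>C x))\<^sup>2 = (cmod a * norm x)\<^sup>2"
    using of_real_eq_iff by blast
  then show ?thesis
    by (simp add: power2_eq_iff_nonneg)
qed

text \<open>Cauchy-Schwarz for a unit vector: the component of \<open>x\<close> orthogonal to
  \<open>e\<close> has squared norm \<open>(norm x)\<^sup>2 - (cmod a)\<^sup>2\<close>, which is
  therefore nonnegative.\<close>

lemma cmod_cinner_le:
  assumes "norm (e::'a::chilbert) = 1"
  shows "cmod (cinner e x) \<le> norm x"
proof -
  define a where "a = cinner e x"
  have xe: "cinner x e = cnj a"
    by (simp add: a_def cinner_commute[of x e])
  have ee: "cinner e e = 1"
    using cinner_self[of e] assms by simp
  have "cinner (x - a *\<^sub>C e) (x - a *\<^sub>C e) = cinner x x - a * cnj a"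
    by (simp add: cinner_diff_left cinner_diff_right cinner_scaleC_left cinner_scaleC_right
        a_def[symmetric] xe ee algebra_simps)
  then have "complex_of_real ((norm (x - a *\<^sub>C e))\<^sup>2) = complex_of_real ((norm x)\<^sup>2 - (cmod a)\<^sup>2)"
    unfolding of_real_diff complex_norm_square cinner_self[symmetric] .
  then have "(norm (x - a *\<^sub>C e))\<^sup>2 = (norm x)\<^sup>2 - (cmod a)\<^sup>2"
    using of_real_eq_iff by blast
  then have "(cmod a)\<^sup>2 \<le> (norm x)\<^sup>2"
    by (smt (verit) zero_le_power2)
  then show ?thesis
    by (simp add: a_def power2_le_iff_abs_le)
qed

section \<open>Closure properties of bounded operators and the operator norm\<close>

lemma bounded_opE:
  assumes "bounded_op A"
  obtains K where "K > 0" "\<And>x. norm (A x) \<le> norm x * K"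
proof -
  from assms obtain K where K: "\<And>x. norm (A x) \<le> norm x * K"
    by (auto simp: bounded_op_def)
  have "norm (A x) \<le> norm x * (\<bar>K\<bar> + 1)" for x
    by (rule order_trans[OF K]) (intro mult_left_mono, auto)
  then show ?thesis
    using that[of "\<bar>K\<bar> + 1"] by auto
qed

lemma bounded_op_plus:
  assumes "bounded_op A" "bounded_op B"
  shows "bounded_op (\<lambda>x. A x + B x)"
proof -
  obtain K L where "\<And>x. norm (A x) \<le> norm x * K" "\<And>x. norm (B x) \<le> norm x * L"
    using bounded_opE assms by metis
  then have "norm (A x + B x) \<le> norm x * (K + L)" for x
    by (metis add_mono distrib_left norm_triangle_mono)
  then show ?thesis
    using assms unfolding bounded_op_def by (auto simp: scaleC_add_right)
qed

lemma bounded_op_scaleC: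
  assumes "bounded_op A"
  shows "bounded_op (\<lambda>x. c *\<^sub>C A x)"
proof -
  obtain K where "\<And>x. norm (A x) \<le> norm x * K"
    using bounded_opE assms by metis
  then have "norm (c *\<^sub>C A x) \<le> norm x * (cmod c * K)" for x
    using mult_left_mono[of "norm (A x)" "norm x * K" "cmod c"]
    by (simp add: norm_scaleC algebra_simps)
  then show ?thesis
    using assms unfolding bounded_op_def by (auto simp: scaleC_add_right scaleC_scaleC mult.commute[of c])
qed

lemma bounded_op_ident: "bounded_op (\<lambda>x. x)"
  unfolding bounded_op_def by (auto intro: exI[of _ 1])

lemma bounded_op_zero: "bounded_op (\<lambda>x. 0)"
  unfolding bounded_op_def by (auto intro: exI[of _ 0])

lemma bounded_op_diff:
  assumes "bounded_op A" "bounded_op B"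
  shows "bounded_op (\<lambda>x. A x - B x)"
  using bounded_op_plus[OF assms(1) bounded_op_scaleC[OF assms(2), of "-1"]]
  by (simp add: scaleC_minus_left scaleC_one)

lemma bounded_op_sum:
  assumes "\<And>i. i \<in> I \<Longrightarrow> bounded_op (A i)"
  shows "bounded_op (\<lambda>x. \<Sum>i\<in>I. A i x)"
  using assms
  by (induction I rule: infinite_finite_induct) (auto intro: bounded_op_plus bounded_op_zero)

lemma bounded_op_cinner:
  assumes "norm (e::'a::chilbert) = 1"
  shows "bounded_op (\<lambda>x. cinner e x *\<^sub>C v)"
proof -
  have "norm (cinner e x *\<^sub>C v) \<le> norm x * norm v" for x
    using cmod_cinner_le[OF assms, of x] by (simp add: norm_scaleC mult_right_mono)
  then show ?thesis
    unfolding bounded_op_def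
    by (auto simp: cinner_add_right cinner_scaleC_right scaleC_add_left scaleC_scaleC)
qed

lemma bounded_op_lin:
  assumes "bounded_op A"
  shows "A 0 = 0" "A (x + y) = A x + A y" "A (c *\<^sub>C x) = c *\<^sub>C A x"
    "A (\<Sum>i\<in>I. u i) = (\<Sum>i\<in>I. A (u i))"
proof -
  show add: "A (x + y) = A x + A y" for x y
    using assms by (simp add: bounded_op_def)
  show "A (c *\<^sub>C x) = c *\<^sub>C A x"
    using assms by (simp add: bounded_op_def)
  show z: "A 0 = 0"
    using add[of 0 0] by simp
  show "A (\<Sum>i\<in>I. u i) = (\<Sum>i\<in>I. A (u i))"
    by (induction I rule: infinite_finite_induct) (auto simp: z add)
qed

lemma opnorm_le:
  assumes "\<And>x. norm x \<le> 1 \<Longrightarrow> norm (A x) \<le> K"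
  shows "opnorm A \<le> K"
  unfolding opnorm_def
  by (rule cSup_least) (use assms in \<open>auto intro: exI[of _ 0]\<close>)

lemma norm_le_opnorm:
  assumes "bounded_op A" "norm x \<le> 1"
  shows "norm (A x) \<le> opnorm A"
proof -
  obtain K where K: "K > 0" "\<And>x. norm (A x) \<le> norm x * K"
    using bounded_opE assms by metis
  have "norm (A y) \<le> K" if "norm y \<le> 1" for y
    using K(2)[of y] mult_right_mono[OF that, of K] K(1) by linarith
  then have "bdd_above {norm (A x) | x. norm x \<le> 1}"
    by (auto intro!: bdd_aboveI[of _ K])
  then show ?thesis
    unfolding opnorm_def using assms(2) by (auto intro!: cSup_upper)
qed

text \<open>This yields uniqueness of the operator described by \<open>fc\<close>. The operator
  vanishes on the unit ball, and every vector is a multiple of a unit vector.\<close>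

lemma bounded_op_eq_zeroI:
  assumes "bounded_op A" "\<And>\<epsilon>. \<epsilon> > 0 \<Longrightarrow> opnorm A < \<epsilon>"
  shows "A x = 0"
proof -
  have unit: "A y = 0" if "norm y \<le> 1" for y
    using norm_le_opnorm[OF assms(1) that] assms(2)
    by (metis dual_order.strict_trans2 less_irrefl norm_le_zero_iff not_le)
  have "A (complex_of_real (norm x) *\<^sub>C (complex_of_real (inverse (norm x)) *\<^sub>C x)) = 0"
    unfolding bounded_op_lin(3)[OF assms(1), of "complex_of_real (norm x)"]
    by (subst unit) (cases "x = 0"; simp add: norm_scaleC norm_inverse)+
  then show ?thesis
    by (cases "x = 0") (auto simp: scaleC_scaleC scaleC_one bounded_op_lin[OF assms(1)] simp flip: of_real_mult)
qed

section \<open>Functional calculus of operators with a finite spectral decomposition\<close>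

text \<open>Newton interpolation: the product \<open>q\<close> vanishes at the old nodes but not at
  the new node \<open>a\<close>, so a multiple of it corrects the value at \<open>a\<close>. On a
  finite spectrum this gives polynomials that agree with the given function exactly.\<close>

lemma interpolation_exists:
  assumes "finite (S::real set)"
  shows "\<exists>p. \<forall>t\<in>S. poly p t = f t"
  using assms
proof (induction S)
  case (insert a S)
  then obtain p where p: "\<forall>t\<in>S. poly p t = f t"
    by blast
  define q where "q = (\<Prod>s\<in>S. [:- s, 1:])"
  have "poly q a \<noteq> 0" "\<forall>t\<in>S. poly q t = 0"
    using insert.hyps by (auto simp: q_def poly_prod)
  then have "\<forall>t\<in>insert a S. poly (p + smult ((f a - poly p a) / poly q a) q) t = f t"
    using p by auto
  then show ?case
    by blast
qed auto

text \<open>A finite resolution of the identity into mutually annihilating idempotents. Some of them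
  may be zero, as happens for the orthogonal complement of an orthonormal pair in dimension two; a
  value \<open>l i\<close> then need not lie in the spectrum of the spectral sum.\<close>

definition spectral_family :: "'i set \<Rightarrow> ('i \<Rightarrow> 'a::chilbert \<Rightarrow> 'a) \<Rightarrow> bool" where
  "spectral_family I P \<longleftrightarrow> finite I \<and> (\<forall>i\<in>I. bounded_op (P i)) \<and>
     (\<forall>i\<in>I. \<forall>j\<in>I. \<forall>x. P i (P j x) = (if i = j then P i x else 0)) \<and> (\<forall>x. (\<Sum>i\<in>I. P i x) = x)"

definition spectral_sum :: "'i set \<Rightarrow> ('i \<Rightarrow> 'a::chilbert \<Rightarrow> 'a) \<Rightarrow> ('i \<Rightarrow> real) \<Rightarrow> 'a \<Rightarrow> 'a" where
  "spectral_sum I P l x = (\<Sum>i\<in>I. complex_of_real (l i) *\<^sub>C P i x)"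

context
  fixes I :: "'i set" and P :: "'i \<Rightarrow> 'a::chilbert \<Rightarrow> 'a"
  assumes fam: "spectral_family I P"
begin

lemma spectral_sum_bounded: "bounded_op (spectral_sum I P l)"
  using fam unfolding spectral_sum_def[abs_def] spectral_family_def
  by (intro bounded_op_sum bounded_op_scaleC) auto

lemma proj_spectral_sum:
  assumes "j \<in> I"
  shows "P j (spectral_sum I P l x) = complex_of_real (l j) *\<^sub>C P j x"
proof -
  have bj: "bounded_op (P j)"
    using fam assms by (simp add: spectral_family_def)
  have "P j (spectral_sum I P l x) = (\<Sum>i\<in>I. complex_of_real (l i) *\<^sub>C P j (P i x))"
    by (simp add: spectral_sum_def bounded_op_lin[OF bj])
  also have "\<dots> = (\<Sum>i\<in>I. if i = j then complex_of_real (l j) *\<^sub>C P j x else 0)"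
    using fam assms by (intro sum.cong) (auto simp: spectral_family_def)
  also have "\<dots> = complex_of_real (l j) *\<^sub>C P j x"
    using fam assms by (simp add: spectral_family_def)
  finally show ?thesis .
qed

lemma spectral_sum_mult:
  "spectral_sum I P l (spectral_sum I P k x) = spectral_sum I P (\<lambda>i. l i * k i) x"
  unfolding spectral_sum_def[of I P l] spectral_sum_def[of I P "\<lambda>i. l i * k i"]
  by (intro sum.cong) (auto simp: proj_spectral_sum scaleC_scaleC)

lemma spectral_sum_const: "spectral_sum I P (\<lambda>i. c) x = complex_of_real c *\<^sub>C x"
  using fam by (simp add: spectral_sum_def spectral_family_def flip: scaleC_sum_right)

lemma spectral_sum_power: "(spectral_sum I P l ^^ n) x = spectral_sum I P (\<lambda>i. l i ^ n) x"
  by (induction n) (auto simp: spectral_sum_mult spectral_sum_const scaleC_one)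

lemma spectral_sum_poly_op:
  "poly_op N c (spectral_sum I P l) x = spectral_sum I P (\<lambda>i. \<Sum>k\<le>N. c k * l i ^ k) x"
proof -
  have "poly_op N c (spectral_sum I P l) x
      = (\<Sum>k\<le>N. \<Sum>i\<in>I. complex_of_real (c k * l i ^ k) *\<^sub>C P i x)"
    unfolding poly_op_def spectral_sum_power
    by (simp add: spectral_sum_def scaleC_sum_right scaleC_scaleC)
  also have "\<dots> = (\<Sum>i\<in>I. \<Sum>k\<le>N. complex_of_real (c k * l i ^ k) *\<^sub>C P i x)"
    by (rule sum.swap)
  also have "\<dots> = spectral_sum I P (\<lambda>i. \<Sum>k\<le>N. c k * l i ^ k) x"
    unfolding spectral_sum_def of_real_sum scaleC_sum_left ..
  finally show ?thesis .
qed

lemma spectral_sum_diff: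
  "spectral_sum I P l x - spectral_sum I P k x = spectral_sum I P (\<lambda>i. l i - k i) x"
  by (simp add: spectral_sum_def scaleC_diff_left sum_subtractf)

text \<open>For \<open>s\<close> outside the values of \<open>l\<close>, the spectral sum of the
  reciprocals \<open>inverse (l i - s)\<close> is the resolvent.\<close>

lemma spectrum_spectral_sum_subset: "real_spectrum (spectral_sum I P l) \<subseteq> l ` I"
proof
  fix s assume s: "s \<in> real_spectrum (spectral_sum I P l)"
  show "s \<in> l ` I"
  proof (rule ccontr)
    assume "s \<notin> l ` I"
    then have ne: "\<And>i. i \<in> I \<Longrightarrow> l i - s \<noteq> 0"
      by auto
    let ?T = "spectral_sum I P (\<lambda>i. l i - s)" and ?S = "spectral_sum I P (\<lambda>i. inverse (l i - s))"
    have one: "spectral_sum I P (\<lambda>i. (l i - s) * inverse (l i - s)) x = x"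
      "spectral_sum I P (\<lambda>i. inverse (l i - s) * (l i - s)) x = x" for x
      using fam ne by (auto simp: spectral_sum_def spectral_family_def scaleC_one simp flip: of_real_mult)
    have "invertible_op ?T"
      unfolding invertible_op_def
      by (intro conjI exI[of _ ?S]) (auto simp: spectral_sum_bounded fun_eq_iff spectral_sum_mult one)
    moreover have "?T = (\<lambda>x. spectral_sum I P l x - complex_of_real s *\<^sub>C x)"
      by (simp add: fun_eq_iff flip: spectral_sum_diff spectral_sum_const)
    ultimately show False
      using s by (simp add: real_spectrum_def)
  qed
qed

text \<open>\<open>P j\<close> annihilates the range of the operator minus \<open>l j\<close>, so a
  vector with nonzero image under \<open>P j\<close> is not in that range.\<close>

lemma in_spectrum_spectral_sum:
  assumes "j \<in> I" "P j x \<noteq> 0"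
  shows "l j \<in> real_spectrum (spectral_sum I P l)"
proof -
  let ?T = "\<lambda>x. spectral_sum I P l x - complex_of_real (l j) *\<^sub>C x"
  have T: "?T = spectral_sum I P (\<lambda>i. l i - l j)"
    by (simp add: fun_eq_iff flip: spectral_sum_diff spectral_sum_const)
  have "\<not> invertible_op ?T"
  proof
    assume "invertible_op ?T"
    then obtain S where "\<And>y. ?T (S y) = y"
      unfolding invertible_op_def by (metis comp_apply id_apply)
    then have "P j x = P j (?T (S x))"
      by simp
    also have "\<dots> = P j (spectral_sum I P (\<lambda>i. l i - l j) (S x))"
      unfolding T[symmetric] ..
    also have "\<dots> = 0"
      using proj_spectral_sum[OF assms(1)] by simp
    finally show False
      using assms(2) by simp
  qed
  then show ?thesis
    by (simp add: real_spectrum_def)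
qed

text \<open>The definite description in \<open>fc\<close> is justified here: \<open>approx\<close>
  gives existence and \<open>uniq\<close> uniqueness.\<close>

lemma fc_spectral_sum: "fc \<phi> (spectral_sum I P l) = spectral_sum I P (\<lambda>i. \<phi> (l i))"
proof -
  let ?T = "spectral_sum I P l" and ?F = "spectral_sum I P (\<lambda>i. \<phi> (l i))"
  let ?approx = "\<lambda>B. \<forall>\<epsilon>>0. \<exists>\<delta>>0. \<forall>N c.
    (\<forall>t\<in>real_spectrum ?T. \<bar>(\<Sum>i\<le>N. c i * t ^ i) - \<phi> t\<bar> < \<delta>)
      \<longrightarrow> opnorm (\<lambda>x. poly_op N c ?T x - B x) < \<epsilon>"
  have fin: "finite I"
    using fam by (simp add: spectral_family_def)
  have "\<forall>i\<in>I. \<exists>K>0. \<forall>x. norm (P i x) \<le> norm x * K"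
    using fam bounded_opE unfolding spectral_family_def by metis
  then obtain K where K: "\<And>i. i \<in> I \<Longrightarrow> K i > 0" "\<And>i x. i \<in> I \<Longrightarrow> norm (P i x) \<le> norm x * K i"
    by metis
  have approx: "?approx ?F"
  proof (intro allI impI)
    fix \<epsilon> :: real assume "\<epsilon> > 0"
    define \<delta> where "\<delta> = \<epsilon> / (2 * (sum K I + 1))"
    have sK: "sum K I \<ge> 0"
      using K(1) by (auto intro!: sum_nonneg simp: less_imp_le)
    then have d: "\<delta> > 0" "\<delta> * sum K I < \<epsilon>"
      using \<open>\<epsilon> > 0\<close> by (auto simp: \<delta>_def field_simps intro: add_nonneg_pos)
    have "opnorm (\<lambda>x. poly_op N c ?T x - ?F x) < \<epsilon>"
      if p: "\<forall>t\<in>real_spectrum ?T. \<bar>(\<Sum>i\<le>N. c i * t ^ i) - \<phi> t\<bar> < \<delta>" for N c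
    proof -
      define k where "k = (\<lambda>i. (\<Sum>j\<le>N. c j * l i ^ j) - \<phi> (l i))"
      have summand: "norm (complex_of_real (k i) *\<^sub>C P i x) \<le> \<delta> * K i" if "i \<in> I" "norm x \<le> 1" for i x
      \<comment> \<open>A vanishing component contributes nothing, however bad the approximation at
        \<open>l i\<close> is. A nonvanishing one puts \<open>l i\<close> into the spectrum, where
        the polynomial is within \<open>\<delta>\<close>.\<close>
      proof (cases "P i x = 0")
        case True
        then show ?thesis
          using d K(1)[OF that(1)] by simp
      next
        case False
        then have "\<bar>k i\<bar> < \<delta>"
          using in_spectrum_spectral_sum[OF that(1) False, of l] p by (simp add: k_def)
        moreover have "norm (P i x) \<le> K i"
          using K(2)[OF that(1), of x] mult_right_mono[OF that(2), of "K i"] K(1)[OF that(1)] by linarith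
        ultimately show ?thesis
          using d K(1)[OF that(1)] by (auto simp: norm_scaleC intro!: mult_mono)
      qed
      have "opnorm (\<lambda>x. poly_op N c ?T x - ?F x) \<le> \<delta> * sum K I"
      proof (rule opnorm_le)
        fix x :: 'a assume x: "norm x \<le> 1"
        have "norm (spectral_sum I P k x) \<le> (\<Sum>i\<in>I. \<delta> * K i)"
          unfolding spectral_sum_def by (rule sum_norm_le) (use summand x in auto)
        then show "norm (poly_op N c ?T x - ?F x) \<le> \<delta> * sum K I"
          by (simp add: spectral_sum_poly_op spectral_sum_diff k_def sum_distrib_left)
      qed
      then show ?thesis
        using d by linarith
    qed
    then show "\<exists>\<delta>>0. \<forall>N c. (\<forall>t\<in>real_spectrum ?T. \<bar>(\<Sum>i\<le>N. c i * t ^ i) - \<phi> t\<bar> < \<delta>)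
      \<longrightarrow> opnorm (\<lambda>x. poly_op N c ?T x - ?F x) < \<epsilon>"
      using d(1) by blast
  qed
  \<comment> \<open>For uniqueness, take a polynomial that interpolates \<open>\<phi>\<close> on all
    values of \<open>l\<close>. It produces \<open>?F\<close> exactly, so any other candidate
    \<open>B\<close> is within every \<open>\<epsilon>\<close> of \<open>?F\<close>.\<close>
  obtain p where p: "\<forall>t\<in>l ` I. poly p t = \<phi> t"
    using interpolation_exists[of "l ` I" \<phi>] fin by auto
  have pF: "poly_op (degree p) (coeff p) ?T x = ?F x" for x
    using p unfolding spectral_sum_poly_op by (simp add: spectral_sum_def flip: poly_altdef)
  have uniq: "B = ?F" if B: "bounded_op B" "?approx B" for B
  proof
    fix x
    have "?F x - B x = 0"
    proof (rule bounded_op_eq_zeroI[where A = "\<lambda>x. ?F x - B x"])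
      show "bounded_op (\<lambda>x. ?F x - B x)"
        by (intro bounded_op_diff spectral_sum_bounded B)
      fix \<epsilon> :: real assume "\<epsilon> > 0"
      then obtain \<delta> where "\<delta> > 0" and \<delta>: "\<forall>N c.
          (\<forall>t\<in>real_spectrum ?T. \<bar>(\<Sum>i\<le>N. c i * t ^ i) - \<phi> t\<bar> < \<delta>)
            \<longrightarrow> opnorm (\<lambda>x. poly_op N c ?T x - B x) < \<epsilon>"
        using B(2) by meson
      have "\<forall>t\<in>real_spectrum ?T. \<bar>(\<Sum>i\<le>degree p. coeff p i * t ^ i) - \<phi> t\<bar> < \<delta>"
        using p spectrum_spectral_sum_subset[of l] \<open>\<delta> > 0\<close> by (auto simp flip: poly_altdef)
      then show "opnorm (\<lambda>x. ?F x - B x) < \<epsilon>"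
        using spec[OF spec[OF \<delta>, of "degree p"], of "coeff p"] by (simp add: pF)
    qed
    then show "B x = ?F x"
      by simp
  qed
  show ?thesis
    unfolding fc_def
  proof (rule the_equality)
    show "bounded_op ?F \<and> ?approx ?F"
      using spectral_sum_bounded approx by (rule conjI)
  qed (use uniq in blast)
qed

end

subsection \<open>Operators acting as a real matrix on an orthonormal pair\<close>

text \<open>With \<open>lo_root\<close>, the eigenvalues of a matrix in terms of its trace
  \<open>\<tau>\<close> and determinant \<open>D\<close>. In this form they depend continuously on
  quantities whose limits are easy to compute.\<close>

definition hi_root :: "real \<Rightarrow> real \<Rightarrow> real" where
  "hi_root \<tau> D = (\<tau> + sqrt (\<tau>\<^sup>2 - 4 * D)) / 2"

definition lo_root :: "real \<Rightarrow> real \<Rightarrow> real" where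
  "lo_root \<tau> D = (\<tau> - sqrt (\<tau>\<^sup>2 - 4 * D)) / 2"

lemma roots:
  assumes "4 * D < \<tau>\<^sup>2"
  shows "lo_root \<tau> D < hi_root \<tau> D" "hi_root \<tau> D + lo_root \<tau> D = \<tau>" "hi_root \<tau> D * lo_root \<tau> D = D"
proof -
  have r: "sqrt (\<tau>\<^sup>2 - 4 * D) * sqrt (\<tau>\<^sup>2 - 4 * D) = \<tau>\<^sup>2 - 4 * D" "sqrt (\<tau>\<^sup>2 - 4 * D) > 0"
    using assms by simp_all
  then show "lo_root \<tau> D < hi_root \<tau> D" "hi_root \<tau> D + lo_root \<tau> D = \<tau>"
    by (simp_all add: hi_root_def lo_root_def field_simps)
  have "hi_root \<tau> D * lo_root \<tau> D = (\<tau>\<^sup>2 - sqrt (\<tau>\<^sup>2 - 4 * D) * sqrt (\<tau>\<^sup>2 - 4 * D)) / 4"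
    by (simp add: hi_root_def lo_root_def power2_eq_square algebra_simps del: r real_sqrt_mult_self)
  then show "hi_root \<tau> D * lo_root \<tau> D = D"
    unfolding r by simp
qed

lemma lo_root_pos:
  assumes "4 * D < \<tau>\<^sup>2" "0 < \<tau>" "0 < D"
  shows "0 < lo_root \<tau> D"
proof -
  have "sqrt (\<tau>\<^sup>2 - 4 * D) < sqrt (\<tau>\<^sup>2)"
    using assms by (intro real_sqrt_less_mono) simp
  then show ?thesis
    using assms by (simp add: lo_root_def)
qed

text \<open>The difference of the two sides is the determinant of the matrix minus
  \<open>l2\<close>, that is, the characteristic polynomial at one of its roots.\<close>

lemma root_shift:
  fixes p q s l1 l2 :: real
  assumes "l1 + l2 = p + s" "l1 * l2 = p * s - q * q"
  shows "(p - l2) * (s - l2) = q * q"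
proof -
  have "(p - l2) * (s - l2) = p * s - l2 * (p + s) + l2 * l2"
    by (simp add: algebra_simps)
  also have "\<dots> = q * q"
    using assms(2) unfolding assms(1)[symmetric] by (simp add: algebra_simps)
  finally show ?thesis .
qed

lemma pd_roots:
  fixes p q s :: real
  assumes pd: "p > 0" "s > 0" "q \<noteq> 0" "q * q < p * s"
  defines "l1 \<equiv> hi_root (p + s) (p * s - q * q)" and "l2 \<equiv> lo_root (p + s) (p * s - q * q)"
  shows "l2 < l1" "l1 + l2 = p + s" "l1 * l2 = p * s - q * q" "0 < l2"
proof -
  have "(p + s)\<^sup>2 - 4 * (p * s - q * q) = (p - s)\<^sup>2 + 4 * q\<^sup>2"
    by (simp add: power2_eq_square algebra_simps)
  moreover have "(p - s)\<^sup>2 + 4 * q\<^sup>2 > 0"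
    using pd(3) by (simp add: add_nonneg_pos)
  ultimately have disc: "4 * (p * s - q * q) < (p + s)\<^sup>2"
    by linarith
  show "l2 < l1" "l1 + l2 = p + s" "l1 * l2 = p * s - q * q" "0 < l2"
    unfolding l1_def l2_def using roots[OF disc] lo_root_pos[OF disc] pd by simp_all
qed

lemma roots_of_product:
  assumes "a \<ge> b"
  shows "hi_root (a + b) (a * b) = a" "lo_root (a + b) (a * b) = b"
proof -
  have "(a + b)\<^sup>2 - 4 * (a * b) = (a - b)\<^sup>2"
    by (simp add: power2_eq_square algebra_simps)
  then show "hi_root (a + b) (a * b) = a" "lo_root (a + b) (a * b) = b"
    using assms by (simp_all add: hi_root_def lo_root_def)
qed

definition slope :: "(real \<Rightarrow> real) \<Rightarrow> real \<Rightarrow> real \<Rightarrow> real" where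
  "slope \<phi> a b = (\<phi> a - \<phi> b) / (a - b)"

section \<open>Block operators and their functional calculus\<close>

locale orthonormal_pair =
  fixes e1 e2 :: "'a::chilbert"
  assumes e11: "cinner e1 e1 = 1" and e22: "cinner e2 e2 = 1" and e12: "cinner e1 e2 = 0"
begin

lemma e21: "cinner e2 e1 = 0"
  using cinner_commute[of e2 e1] e12 by simp

text \<open>The operator with matrix rows \<open>(p, q)\<close> and \<open>(r, s)\<close> on the
  span of the pair and the scalar \<open>w\<close> on the orthogonal complement. Subtracting
  \<open>w\<close> on the diagonal allows the last summand to be \<open>w\<close> times the
  identity, so that no projection onto the complement is needed.\<close>

definition block :: "real \<Rightarrow> real \<Rightarrow> real \<Rightarrow> real \<Rightarrow> real \<Rightarrow> 'a \<Rightarrow> 'a" where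
  "block p q r s w x =
     (complex_of_real (p - w) * cinner e1 x + complex_of_real q * cinner e2 x) *\<^sub>C e1
     + (complex_of_real r * cinner e1 x + complex_of_real (s - w) * cinner e2 x) *\<^sub>C e2
     + complex_of_real w *\<^sub>C x"

lemma norm_e: "norm e1 = 1" "norm e2 = 1"
  using e11 e22 by (simp_all add: norm_eq_sqrt_cinner)

lemma cinner_block:
  "cinner e1 (block p q r s w x) = complex_of_real p * cinner e1 x + complex_of_real q * cinner e2 x"
  "cinner e2 (block p q r s w x) = complex_of_real r * cinner e1 x + complex_of_real s * cinner e2 x"
  by (simp_all add: block_def cinner_add_right cinner_scaleC_right e11 e22 e12 e21 algebra_simps)

lemma bounded_op_block: "bounded_op (block p q r s w)"
  unfolding block_def[abs_def] scaleC_add_left scaleC_scaleC[symmetric]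
  by (intro bounded_op_plus bounded_op_scaleC bounded_op_cinner bounded_op_ident norm_e)

lemma block_compose:
  "block p q r s w (block p' q' r' s' w' x)
    = block (p * p' + q * r') (p * q' + q * s') (r * p' + s * r') (r * q' + s * s') (w * w') x"
proof -
  have collect: "a *\<^sub>C e1 + b *\<^sub>C e2 + c *\<^sub>C (a' *\<^sub>C e1 + b' *\<^sub>C e2 + c' *\<^sub>C x)
      = (a + c * a') *\<^sub>C e1 + (b + c * b') *\<^sub>C e2 + (c * c') *\<^sub>C x" for a b c a' b' c'
    by (simp add: scaleC_add_left scaleC_add_right scaleC_scaleC algebra_simps)
  have cong: "a = a' \<Longrightarrow> b = b' \<Longrightarrow> c = c' \<Longrightarrow>
      a *\<^sub>C e1 + b *\<^sub>C e2 + c *\<^sub>C x = a' *\<^sub>C e1 + b' *\<^sub>C e2 + c' *\<^sub>C x" for a b c a' b' c'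
    by simp
  show ?thesis
    unfolding block_def[of p q r s w] cinner_block
    unfolding block_def collect
    by (rule cong) (simp_all add: algebra_simps)
qed

lemma block_id: "block 1 0 0 1 1 = id"
  by (simp add: fun_eq_iff block_def scaleC_one)

lemma block_add:
  "block p q r s w x + block p' q' r' s' w' x = block (p + p') (q + q') (r + r') (s + s') (w + w') x"
  by (simp add: block_def scaleC_add_left algebra_simps scaleC_diff_left)

lemma block_scale:
  "complex_of_real c *\<^sub>C block p q r s w x = block (c * p) (c * q) (c * r) (c * s) (c * w) x"
  by (simp add: block_def scaleC_add_left scaleC_add_right scaleC_scaleC algebra_simps scaleC_diff_left scaleC_diff_right)

text \<open>The entries are inner products with \<open>e1\<close> and \<open>e2\<close>. Nothing
  follows for \<open>w\<close>, since the complement of the pair is zero in dimension two.\<close>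

lemma block_entries_eq:
  assumes "block p q r s w = block p' q' r' s' w'"
  shows "p = p'" "q = q'" "r = r'" "s = s'"
proof -
  have "cinner e (block p q r s w x) = cinner e (block p' q' r' s' w' x)" for e x
    using assms by simp
  from this[of e1 e1] this[of e1 e2] this[of e2 e1] this[of e2 e2]
  show "p = p'" "q = q'" "r = r'" "s = s'"
    by (simp_all add: cinner_block e11 e22 e12 e21)
qed

lemma block_zero: "block 0 0 0 0 0 x = 0"
  by (simp add: block_def)

text \<open>Index 0 is a projection inside the span of the pair, index 1 its complement in the span,
  and index 2 the projection onto the orthogonal complement of the span.\<close>

definition block_proj :: "real \<Rightarrow> real \<Rightarrow> real \<Rightarrow> nat \<Rightarrow> 'a \<Rightarrow> 'a" where
  "block_proj p q s i = (if i = 0 then block p q q s 0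
     else if i = 1 then block (1 - p) (- q) (- q) (1 - s) 0 else block 0 0 0 0 1)"

lemma block_proj_family:
  assumes "p * p + q * q = p" "p * q + q * s = q" "q * q + s * s = s"
  shows "spectral_family {0, 1, 2::nat} (block_proj p q s)"
proof -
  have [simp]: "p * p = p - q * q" "s * s = s - q * q"  "q * p = q - q * s" "p * q = q - q * s" "s * q = q * s"
    using assms by (simp_all add: algebra_simps)
  show ?thesis
    unfolding spectral_family_def
    by (auto simp: block_proj_def bounded_op_block block_compose block_zero block_add algebra_simps block_id)
qed

lemma spectral_sum_block_proj:
  "spectral_sum {0, 1, 2::nat} (block_proj p q s) l
    = block (l 0 * p + l 1 * (1 - p)) ((l 0 - l 1) * q) ((l 0 - l 1) * q) (l 0 * s + l 1 * (1 - s)) (l 2)"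
  by (rule ext) (simp add: spectral_sum_def block_proj_def block_add block_scale algebra_simps)

text \<open>The coordinate projections are used, so the diagonal entries may coincide. The formula
  of \<open>fc_block\<close> divides by the difference of the eigenvalues and excludes that
  case.\<close>

lemma fc_block_diag: "fc \<phi> (block p 0 0 s w) = block (\<phi> p) 0 0 (\<phi> s) (\<phi> w)"
proof -
  let ?l = "\<lambda>i::nat. if i = 0 then p else if i = 1 then s else w"
  have fam: "spectral_family {0, 1, 2::nat} (block_proj 1 0 0)"
    by (rule block_proj_family) auto
  have "fc \<phi> (spectral_sum {0, 1, 2::nat} (block_proj 1 0 0) ?l)
      = spectral_sum {0, 1, 2::nat} (block_proj 1 0 0) (\<lambda>i. \<phi> (?l i))"
    by (rule fc_spectral_sum[OF fam])
  then show ?thesis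
    unfolding spectral_sum_block_proj by simp
qed

text \<open>For a matrix T, the eigenprojection of \<open>l1\<close> is
  \<open>(T - l2) / (l1 - l2)\<close>, with entries \<open>P\<close>, \<open>Q\<close>,
  \<open>S\<close>. It is idempotent because its trace is 1 and its determinant 0.\<close>

lemma fc_block:
  fixes \<phi> :: "real \<Rightarrow> real"
  assumes "l1 \<noteq> l2" "l1 + l2 = p + s" "l1 * l2 = p * s - q * q"
  defines "c \<equiv> (\<phi> l1 - \<phi> l2) / (l1 - l2)"
  shows "fc \<phi> (block p q q s w)
    = block (\<phi> l2 + c * (p - l2)) (c * q) (c * q) (\<phi> l2 + c * (s - l2)) (\<phi> w)"
    (is "_ = ?R")
proof -
  define P Q S where "P = (p - l2) / (l1 - l2)" and "Q = q / (l1 - l2)" and "S = (s - l2) / (l1 - l2)"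
  have ne: "l1 - l2 \<noteq> 0"
    using assms by simp
  have PS: "p = P * (l1 - l2) + l2" "q = Q * (l1 - l2)" "s = S * (l1 - l2) + l2"
    using ne by (simp_all add: P_def Q_def S_def)
  have tr: "P + S = 1"
  proof -
    have "(P + S) * (l1 - l2) = 1 * (l1 - l2)"
      using assms(2) PS by (simp add: algebra_simps)
    then show ?thesis
      using ne by simp
  qed
  have det: "P * S = Q * Q"
  proof -
    have "(p - l2) * (s - l2) = q * q"
      by (rule root_shift[OF assms(2,3)])
    then have "(P * S) * (l1 - l2)\<^sup>2 = (Q * Q) * (l1 - l2)\<^sup>2"
      using PS by (simp add: power2_eq_square algebra_simps)
    then show ?thesis
      using ne by simp
  qed
  let ?l = "\<lambda>i::nat. if i = 0 then l1 else if i = 1 then l2 else w"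
  have "P * P + Q * Q = P" "P * Q + Q * S = Q" "Q * Q + S * S = S"
  proof -
    have "P * (P + S) = P" "Q * (P + S) = Q" "S * (P + S) = S"
      by (simp_all add: tr)
    then show "P * P + Q * Q = P" "P * Q + Q * S = Q" "Q * Q + S * S = S"
      using det by (simp_all add: distrib_left mult.commute)
  qed
  then have fam: "spectral_family {0, 1, 2::nat} (block_proj P Q S)"
    by (rule block_proj_family)
  have "fc \<phi> (spectral_sum {0, 1, 2::nat} (block_proj P Q S) ?l)
      = spectral_sum {0, 1, 2::nat} (block_proj P Q S) (\<lambda>i. \<phi> (?l i))"
    by (rule fc_spectral_sum[OF fam])
  moreover have "spectral_sum {0, 1, 2::nat} (block_proj P Q S) ?l = block p q q s w"
    unfolding spectral_sum_block_proj PS(1,2,3) by (simp add: algebra_simps)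
  moreover have "spectral_sum {0, 1, 2::nat} (block_proj P Q S) (\<lambda>i. \<phi> (?l i)) = ?R"
  proof -
    have c: "c * (p - l2) = (\<phi> l1 - \<phi> l2) * P" "c * q = (\<phi> l1 - \<phi> l2) * Q" "c * (s - l2) = (\<phi> l1 - \<phi> l2) * S"
      by (simp_all add: c_def P_def Q_def S_def)
    show ?thesis
      unfolding spectral_sum_block_proj c by (simp add: algebra_simps)
  qed
  ultimately show ?thesis
    by simp
qed

text \<open>Splitting off the part \<open>z\<close> of \<open>x\<close> orthogonal to the pair
  reduces positivity to the 2 by 2 form plus \<open>w * (norm z)\<^sup>2\<close>. The cross term is
  controlled by the inequality of arithmetic and geometric means with weights \<open>sqrt p\<close>
  and \<open>sqrt s\<close>. The inverse is the adjugate divided by the determinant.\<close>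

lemma pos_def_block:
  assumes "p > 0" "s > 0" "q * q < p * s" "w > 0"
  shows "pos_def_op (block p q q s w)"
proof -
  have "Im (cinner x (block p q q s w x)) = 0 \<and> 0 \<le> Re (cinner x (block p q q s w x))" for x
  proof -
    define a b where "a = cinner e1 x" and "b = cinner e2 x"
    define z where "z = x - a *\<^sub>C e1 - b *\<^sub>C e2"
    have x12: "cinner x e1 = cnj a" "cinner x e2 = cnj b"
      using cinner_commute[of x e1] cinner_commute[of x e2] by (simp_all add: a_def b_def)
    have zz: "complex_of_real ((norm z)\<^sup>2) = cinner x x - a * cnj a - b * cnj b"
      unfolding cinner_self[symmetric] z_def
      by (simp add: cinner_diff_left cinner_diff_right cinner_scaleC_left cinner_scaleC_right
          a_def[symmetric] b_def[symmetric] x12 e11 e22 e12 e21 mult.commute)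
    have eq: "cinner x (block p q q s w x) = complex_of_real p * (a * cnj a) + complex_of_real s * (b * cnj b)
       + complex_of_real q * (a * cnj b + cnj (a * cnj b)) + complex_of_real (w * (norm z)\<^sup>2)"
      unfolding of_real_mult[of w] zz
      by (simp add: block_def cinner_add_right cinner_scaleC_right a_def[symmetric] b_def[symmetric] x12 algebra_simps)
    have eq': "cinner x (block p q q s w x) = complex_of_real (p * (cmod a)\<^sup>2 + s * (cmod b)\<^sup>2
       + q * (2 * Re (a * cnj b)) + w * (norm z)\<^sup>2)"
      unfolding eq complex_add_cnj complex_norm_square[symmetric] by simp
    have "\<bar>Re (a * cnj b)\<bar> \<le> cmod a * cmod b"
      using abs_Re_le_cmod[of "a * cnj b"] by (simp add: norm_mult)
    then have "\<bar>q * (2 * Re (a * cnj b))\<bar> \<le> 2 * \<bar>q\<bar> * (cmod a * cmod b)"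
      using mult_left_mono[of "\<bar>Re (a * cnj b)\<bar>" "cmod a * cmod b" "2 * \<bar>q\<bar>"]
      by (simp only: abs_mult) simp
    moreover have "2 * \<bar>q\<bar> * (cmod a * cmod b) \<le> p * (cmod a)\<^sup>2 + s * (cmod b)\<^sup>2"
    proof -
      have "\<bar>q\<bar> \<le> sqrt p * sqrt s"
        using assms real_sqrt_le_mono[of "q * q" "p * s"]
        by (simp add: real_sqrt_mult flip: power2_eq_square)
      then have "2 * \<bar>q\<bar> * (cmod a * cmod b) \<le> 2 * (sqrt p * sqrt s) * (cmod a * cmod b)"
        by (intro mult_right_mono mult_left_mono) auto
      also have "\<dots> \<le> (sqrt p * cmod a)\<^sup>2 + (sqrt s * cmod b)\<^sup>2"
        using sum_squares_bound[of "sqrt p * cmod a" "sqrt s * cmod b"] by (simp add: mult_ac)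
      finally show ?thesis
        using assms by (simp add: power_mult_distrib)
    qed
    moreover have "0 \<le> w * (norm z)\<^sup>2"
      using assms by simp
    ultimately show ?thesis
      unfolding eq' by simp
  qed
  moreover have "invertible_op (block p q q s w)"
  proof -
    define D where "D = p * s - q * q"
    have D: "D \<noteq> 0"
      using assms by (simp add: D_def)
    have "p * (s / D) + q * (- q / D) = 1" "p * (- q / D) + q * (p / D) = 0"
      "q * (s / D) + s * (- q / D) = 0" "q * (- q / D) + s * (p / D) = 1"
      using D by (simp_all add: divide_simps) (simp_all add: D_def algebra_simps)
    then have *: "p * (s / D) + q * (- q / D) = 1" "p * (- q / D) + q * (p / D) = 0"
      "q * (s / D) + s * (- q / D) = 0" "q * (- q / D) + s * (p / D) = 1"
      "s / D * p + - q / D * q = 1" "s / D * q + - q / D * s = 0"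
      "- q / D * p + p / D * q = 0" "- q / D * q + p / D * s = 1" "w * (1 / w) = 1" "1 / w * w = 1"
      using assms by (simp_all add: algebra_simps)
    show ?thesis
      unfolding invertible_op_def
    proof (intro conjI exI[of _ "block (s / D) (- q / D) (- q / D) (p / D) (1 / w)"] bounded_op_block)
    qed (auto simp only: fun_eq_iff comp_apply block_compose * block_id)
  qed
  ultimately show ?thesis
    by (simp add: pos_def_op_def positive_op_def bounded_op_block)
qed


lemma block_comp:
  "block p q r s w \<circ> block p' q' r' s' w'
    = block (p * p' + q * r') (p * q' + q * s') (r * p' + s * r') (r * q' + s * s') (w * w')"
  by (simp add: fun_eq_iff block_compose)

text \<open>Trace and determinant show that the image block has eigenvalues \<open>\<phi> l1\<close>
  and \<open>\<phi> l2\<close>. The divided differences of \<open>\<psi>\<close> and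
  \<open>\<phi>\<close> then multiply to that of the composition, as in the chain rule.\<close>

lemma fc_fc_block:
  assumes "l1 \<noteq> l2" "l1 + l2 = p + s" "l1 * l2 = p * s - q * q" "\<phi> l1 \<noteq> \<phi> l2"
  shows "fc \<psi> (fc \<phi> (block p q q s w)) = fc (\<lambda>t. \<psi> (\<phi> t)) (block p q q s w)"
proof -
  define c where "c = slope \<phi> l1 l2"
  have d: "(p - l2) * (s - l2) = q * q"
    by (rule root_shift[OF assms(2,3)])
  have cl: "c * (l1 - l2) = \<phi> l1 - \<phi> l2"
    using assms(1) by (simp add: c_def slope_def)
  have 1: "fc \<phi> (block p q q s w)
      = block (\<phi> l2 + c * (p - l2)) (c * q) (c * q) (\<phi> l2 + c * (s - l2)) (\<phi> w)"
    unfolding c_def slope_def by (rule fc_block[OF assms(1-3)])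
  have ps: "(p - l2) + (s - l2) = l1 - l2"
    using assms(2) by simp
  have tr: "\<phi> l1 + \<phi> l2 = (\<phi> l2 + c * (p - l2)) + (\<phi> l2 + c * (s - l2))"
  proof -
    have "(\<phi> l2 + c * (p - l2)) + (\<phi> l2 + c * (s - l2)) = 2 * \<phi> l2 + c * ((p - l2) + (s - l2))"
      by (simp add: algebra_simps)
    then show ?thesis
      unfolding ps cl by simp
  qed
  have det: "\<phi> l1 * \<phi> l2 = (\<phi> l2 + c * (p - l2)) * (\<phi> l2 + c * (s - l2)) - c * q * (c * q)"
  proof -
    have "(\<phi> l2 + c * (p - l2)) * (\<phi> l2 + c * (s - l2)) - c * q * (c * q)
      = \<phi> l2 * \<phi> l2 + \<phi> l2 * (c * ((p - l2) + (s - l2))) + c * c * ((p - l2) * (s - l2) - q * q)"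
      by (simp add: algebra_simps)
    then show ?thesis
      unfolding ps cl d by (simp add: algebra_simps)
  qed
  define C where "C = (\<psi> (\<phi> l1) - \<psi> (\<phi> l2)) / (\<phi> l1 - \<phi> l2)"
  have "C * c = (\<psi> (\<phi> l1) - \<psi> (\<phi> l2)) / (l1 - l2)"
    using assms(4) by (simp add: C_def c_def slope_def)
  then show ?thesis
    using fc_block[OF assms(4) tr det, of \<psi> "\<phi> w"] fc_block[OF assms(1-3), of "\<lambda>t. \<psi> (\<phi> t)" w]
    unfolding 1 C_def[symmetric] by (simp add: mult.assoc[symmetric])
qed

lemma fc_block_ident:
  assumes "l1 \<noteq> l2" "l1 + l2 = p + s" "l1 * l2 = p * s - q * q" "\<phi> l1 = l1" "\<phi> l2 = l2" "\<phi> w = w"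
  shows "fc \<phi> (block p q q s w) = block p q q s w"
  unfolding fc_block[OF assms(1-3)] assms(4-6) using assms(1) by simp

text \<open>The image is again a positive definite block with nonzero off-diagonal entry, namely
  \<open>q\<close> scaled by the divided difference, so the functional calculus can be applied to it
  once more.\<close>

lemma fc_block_pd:
  assumes pd: "p > 0" "s > 0" "q \<noteq> 0" "q * q < p * s"
    and mono: "strict_mono_on {0<..} \<phi>" and pos: "\<And>t. t > 0 \<Longrightarrow> \<phi> t > 0"
  defines "c \<equiv> slope \<phi> (hi_root (p + s) (p * s - q * q)) (lo_root (p + s) (p * s - q * q))"
  obtains P S where "fc \<phi> (block p q q s w) = block P (c * q) (c * q) S (\<phi> w)"
    "P > 0" "S > 0" "(c * q) * (c * q) < P * S" "c > 0"
proof -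
  define l1 l2 where "l1 = hi_root (p + s) (p * s - q * q)" and "l2 = lo_root (p + s) (p * s - q * q)"
  have l: "l2 < l1" "l1 + l2 = p + s" "l1 * l2 = p * s - q * q" "0 < l2"
    unfolding l1_def l2_def by (rule pd_roots[OF pd])+
  have ne: "l1 \<noteq> l2"
    using l by simp
  have \<phi>: "\<phi> l2 < \<phi> l1" "\<phi> l2 > 0"
    using strict_mono_onD[OF mono, of l2 l1] pos l by simp_all
  have c: "c > 0" "c = (\<phi> l1 - \<phi> l2) / (l1 - l2)"
    using \<phi> l by (simp_all add: c_def slope_def l1_def l2_def)
  \<comment> \<open>The numbers \<open>p - l2\<close> and \<open>s - l2\<close> have positive
    product \<open>q * q\<close> and positive sum \<open>l1 - l2\<close>, so both are
    positive.\<close>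
  have d: "(p - l2) * (s - l2) = q * q"
    by (rule root_shift[OF l(2,3)])
  moreover have "q * q > 0"
    using pd(3) by (simp add: zero_less_mult_iff) linarith
  ultimately have "0 < (p - l2) * (s - l2)"
    by simp
  then have "p - l2 > 0" "s - l2 > 0"
    using l(1,2) by (auto simp: zero_less_mult_iff)
  then have pos: "\<phi> l2 + c * (p - l2) > 0" "\<phi> l2 + c * (s - l2) > 0"
    using \<phi>(2) c(1) by (simp_all add: add_pos_pos)
  have "(\<phi> l2 + c * (p - l2)) * (\<phi> l2 + c * (s - l2)) - c * q * (c * q)
      = \<phi> l2 * \<phi> l2 + \<phi> l2 * (c * ((p - l2) + (s - l2))) + c * c * ((p - l2) * (s - l2) - q * q)"
    by (simp add: algebra_simps)
  also have "\<dots> > 0"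
    unfolding d diff_self mult_zero_right add_0_right
    using \<phi>(2) c(1) \<open>p - l2 > 0\<close> \<open>s - l2 > 0\<close> by (intro add_pos_pos mult_pos_pos)
  finally have "(c * q) * (c * q) < (\<phi> l2 + c * (p - l2)) * (\<phi> l2 + c * (s - l2))"
    by simp
  then show ?thesis
    using that fc_block[OF ne l(2,3), of \<phi> w] pos c unfolding c(2)[symmetric] by blast
qed

text \<open>The functional calculus of the inverse function undoes \<open>fc \<phi>\<close>. With
  \<open>\<phi>\<close> equal to \<open>g\<close>, this cancels the outer \<open>g\<close> in the
  associativity hypothesis.\<close>

lemma fc_block_inj:
  assumes pd: "p > 0" "s > 0" "q \<noteq> 0" "q * q < p * s" "w > 0"
    and pd': "p' > 0" "s' > 0" "q' \<noteq> 0" "q' * q' < p' * s'" "w' > 0"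
    and inj: "inj_on \<phi> {0<..}"
    and eq: "fc \<phi> (block p q q s w) = fc \<phi> (block p' q' q' s' w')"
  shows "block p q q s w = block p' q' q' s' w'"
proof -
  let ?\<psi> = "inv_into {0<..} \<phi>"
  have inv: "?\<psi> (\<phi> t) = t" if "t > 0" for t
    using inv_into_f_f[OF inj, of t] that by simp
  have recover: "fc ?\<psi> (fc \<phi> (block p q q s w)) = block p q q s w"
    if pd: "p > 0" "s > 0" "q \<noteq> 0" "q * q < p * s" "w > 0" for p q s w
  proof -
    obtain l1 l2 where l: "l1 \<noteq> l2" "l1 + l2 = p + s" "l1 * l2 = p * s - q * q" and pos: "0 < l1" "0 < l2"
      using pd_roots[OF pd(1-4)] by (metis less_irrefl less_trans)
    have ne: "\<phi> l1 \<noteq> \<phi> l2"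
      using inv l pos by metis
    show ?thesis
      unfolding fc_fc_block[OF l ne] by (rule fc_block_ident[OF l]) (use inv pos pd in auto)
  qed
  show ?thesis
    using recover[OF pd] recover[OF pd'] eq by metis
qed

section \<open>Kubo-Ando means of block operators\<close>

lemma km_mean_diag:
  assumes "x > 0" "y > 0" "w > 0"
  shows "km_mean f (block x 0 0 y w) (block p 0 0 s v)
    = block (x * f (p / x)) 0 0 (y * f (s / y)) (w * f (v / w))"
proof -
  have "inverse (sqrt a) * b * inverse (sqrt a) = b / a" "sqrt a * c * sqrt a = a * c" if "a > 0" for a b c
    using that by (simp_all add: field_simps)
  note sq = this[OF assms(1)] this[OF assms(2)] this[OF assms(3)]
  show ?thesis
    by (simp only: km_mean_def fc_block_diag block_comp mult_zero_left mult_zero_right add_0_left add_0_right sq)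
qed

lemma km_mean_id:
  assumes "x > 0" "y > 0" "w > 0" and symm: "\<forall>t>0. t * f (1 / t) = f t"
  shows "km_mean f (block x 0 0 y w) id = block (f x) 0 0 (f y) (f w)"
  unfolding block_id[symmetric] km_mean_diag[OF assms(1-3)] using assms by simp

lemma id_km_mean: "km_mean f id (block p q r s w) = fc f (block p q r s w)"
  unfolding block_id[symmetric] km_mean_def fc_block_diag by (simp add: block_id)

text \<open>The inner conjugation divides the off-diagonal entry by \<open>sqrt x * sqrt y\<close>
  and the outer one multiplies it back. What remains is the divided difference of \<open>f\<close>
  at the eigenvalues of the conjugated matrix, whose trace and determinant are \<open>\<tau>\<close>
  and \<open>D\<close>. The positivity facts are those required by
  \<open>fc_block_inj\<close>.\<close>

lemma km_mean_offdiag: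
  assumes xyw: "x > 0" "y > 0" "w > 0" and pd: "p > 0" "s > 0" "q \<noteq> 0" "q * q < p * s" "v > 0"
    and f_mono: "strict_mono_on {0<..} f" and f_pos: "\<And>t. t > 0 \<Longrightarrow> f t > 0"
  defines "\<tau> \<equiv> p / x + s / y" and "D \<equiv> (p * s - q * q) / (x * y)"
  obtains P S V where "km_mean f (block x 0 0 y w) (block p q q s v)
      = block P (slope f (hi_root \<tau> D) (lo_root \<tau> D) * q) (slope f (hi_root \<tau> D) (lo_root \<tau> D) * q) S V"
    "P > 0" "S > 0" "V > 0" "(slope f (hi_root \<tau> D) (lo_root \<tau> D) * q) * (slope f (hi_root \<tau> D) (lo_root \<tau> D) * q) < P * S"
    "slope f (hi_root \<tau> D) (lo_root \<tau> D) > 0"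
proof -
  define r where "r = sqrt x * sqrt y"
  have r: "r > 0" "r * r = x * y"
    using xyw by (simp_all add: r_def flip: real_sqrt_mult)
  have 1: "inverse (sqrt a) * b * inverse (sqrt a) = b / a" "sqrt a * c * sqrt a = a * c" if "a > 0" for a b c
    using that by (simp_all add: field_simps)
  have 2: "inverse (sqrt x) * q * inverse (sqrt y) = q / r" "inverse (sqrt y) * q * inverse (sqrt x) = q / r"
    "sqrt x * c * sqrt y = r * c" "sqrt y * c * sqrt x = r * c" for c
    by (simp_all add: r_def field_simps)
  note sq = 1[OF xyw(1)] 1[OF xyw(2)] 1[OF xyw(3)] 2
  have T: "fc (\<lambda>t. inverse (sqrt t)) (block x 0 0 y w) \<circ> block p q q s v \<circ> fc (\<lambda>t. inverse (sqrt t)) (block x 0 0 y w)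
      = block (p / x) (q / r) (q / r) (s / y) (v / w)"
    by (simp only: fc_block_diag block_comp mult_zero_left mult_zero_right add_0_left add_0_right sq)
  have pd': "p / x > 0" "s / y > 0" "q / r \<noteq> 0" "q / r * (q / r) < p / x * (s / y)"
    using pd xyw r by (auto simp: divide_strict_right_mono)
  have D: "p / x * (s / y) - q / r * (q / r) = D"
    using r by (simp add: D_def diff_divide_distrib)
  obtain P S where F: "fc f (block (p / x) (q / r) (q / r) (s / y) (v / w))
      = block P (slope f (hi_root \<tau> D) (lo_root \<tau> D) * (q / r)) (slope f (hi_root \<tau> D) (lo_root \<tau> D) * (q / r)) S (f (v / w))"
    and PS: "P > 0" "S > 0" "(slope f (hi_root \<tau> D) (lo_root \<tau> D) * (q / r)) * (slope f (hi_root \<tau> D) (lo_root \<tau> D) * (q / r)) < P * S"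
      "slope f (hi_root \<tau> D) (lo_root \<tau> D) > 0"
    using fc_block_pd[OF pd' f_mono f_pos, of "v / w", unfolded D \<tau>_def[symmetric]] by metis
  define c where "c = slope f (hi_root \<tau> D) (lo_root \<tau> D)"
  have "km_mean f (block x 0 0 y w) (block p q q s v)
      = block (x * P) (r * (c * (q / r))) (r * (c * (q / r))) (y * S) (w * f (v / w))"
    unfolding km_mean_def T F c_def[symmetric]
    by (simp only: fc_block_diag block_comp mult_zero_left mult_zero_right add_0_left add_0_right sq)
  moreover have rc: "r * (c * (q / r)) = c * q"
    using r by simp
  moreover have "(c * q) * (c * q) < (x * P) * (y * S)"
  proof -
    have "(c * q) * (c * q) = (r * r) * ((c * (q / r)) * (c * (q / r)))"
      unfolding rc[symmetric] by (simp only: mult_ac)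
    also have "\<dots> < (r * r) * (P * S)"
      using PS(3) r(1) by (intro mult_strict_left_mono) (simp_all only: c_def mult_pos_pos)
    finally show ?thesis
      by (simp add: r mult_ac)
  qed
  ultimately show ?thesis
    using that[of "x * P" "y * S" "w * f (v / w)"] PS xyw pd f_pos by (simp add: c_def)
qed

end

text \<open>Gram-Schmidt for two vectors. The assumption that no single vector spans the space
  expresses dimension at least two.\<close>

lemma orthonormal_pair_exists:
  assumes "\<not> (\<exists>v::'a::chilbert. \<forall>x::'a. \<exists>c. x = c *\<^sub>C v)"
  shows "\<exists>e1 e2 :: 'a. orthonormal_pair e1 e2"
proof -
  have normalize: "cinner u u = 1" if "u = complex_of_real (inverse (norm v)) *\<^sub>C v" "v \<noteq> 0" for u v :: 'a
    using that by (simp add: cinner_self norm_scaleC norm_inverse)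
  obtain v :: 'a where v: "v \<noteq> 0"
    using assms by (metis scaleC_zero_left)
  define e1 where "e1 = complex_of_real (inverse (norm v)) *\<^sub>C v"
  have e1: "cinner e1 e1 = 1"
    using normalize e1_def v by blast
  obtain x where x: "\<And>c. x \<noteq> c *\<^sub>C e1"
    using assms by blast
  define z where "z = x - cinner e1 x *\<^sub>C e1"
  have z: "z \<noteq> 0" "cinner e1 z = 0"
    using x by (simp_all add: z_def cinner_diff_right cinner_scaleC_right e1)
  define e2 where "e2 = complex_of_real (inverse (norm z)) *\<^sub>C z"
  have "orthonormal_pair e1 e2"
  proof
    show "cinner e2 e2 = 1"
      using normalize e2_def z by blast
    show "cinner e1 e2 = 0"
      by (simp add: e2_def cinner_scaleC_right z)
  qed (rule e1)
  then show ?thesis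
    by blast
qed

subsection \<open>Matrix monotone functions\<close>

lemma mat_adjoint_index [simp]:
  assumes "i < dim_col A" "j < dim_row A"
  shows "mat_adjoint A $$ (i, j) = conjugate (A $$ (j, i))"
  using assms by (simp add: mat_adjoint_def mat_of_rows_index)

lemma dim_mat_adjoint [simp]: "dim_row (mat_adjoint A) = dim_col A" "dim_col (mat_adjoint A) = dim_row A"
  by (simp_all add: mat_adjoint_def)

lemma diag_of_carrier [simp]: "diag_of n d \<in> carrier_mat n n"
  by (simp add: diag_of_def)

lemma diag_of_mult_left:
  assumes "W \<in> carrier_mat n n" "i < n" "j < n"
  shows "(diag_of n d * W) $$ (i, j) = complex_of_real (d i) * W $$ (i, j)"
proof -
  have "(diag_of n d * W) $$ (i, j) = (\<Sum>k\<in>{0..<n}. diag_of n d $$ (i, k) * W $$ (k, j))"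
    using assms by (simp add: scalar_prod_def diag_of_def)
  also have "\<dots> = (\<Sum>k\<in>{0..<n}. if k = i then complex_of_real (d i) * W $$ (i, j) else 0)"
    using assms by (intro sum.cong) (auto simp: diag_of_def)
  finally show ?thesis
    using assms by simp
qed

lemma diag_of_mult_right:
  assumes "W \<in> carrier_mat n n" "i < n" "j < n"
  shows "(W * diag_of n d) $$ (i, j) = W $$ (i, j) * complex_of_real (d j)"
proof -
  have "(W * diag_of n d) $$ (i, j) = (\<Sum>k\<in>{0..<n}. W $$ (i, k) * diag_of n d $$ (k, j))"
    using assms by (simp add: scalar_prod_def diag_of_def)
  also have "\<dots> = (\<Sum>k\<in>{0..<n}. if k = j then W $$ (i, j) * complex_of_real (d j) else 0)"
    using assms by (intro sum.cong) (auto simp: diag_of_def)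
  finally show ?thesis
    using assms by simp
qed

text \<open>\<open>mat_fc\<close> selects some diagonalisation by choice. If \<open>W\<close> is the
  transition matrix between two of them, then each entry of \<open>W\<close> is zero or links equal
  eigenvalues. Hence \<open>W\<close> also intertwines the diagonal matrices after \<open>f\<close>
  is applied.\<close>

lemma mat_fc_unitary:
  assumes U: "unitary_mat n U" and A: "A = U * diag_of n d * mat_adjoint U"
  shows "mat_fc n f A = U * diag_of n (\<lambda>i. f (d i)) * mat_adjoint U"
proof -
  let ?D = "diag_of n d" and ?F = "diag_of n (\<lambda>i. f (d i))"
  let ?P = "\<lambda>B. \<exists>U d. unitary_mat n U \<and> A = U * diag_of n d * mat_adjoint U
      \<and> B = U * diag_of n (\<lambda>i. f (d i)) * mat_adjoint U"
  have "?P (U * ?F * mat_adjoint U)"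
    using U A by blast
  then have "?P (mat_fc n f A)"
    unfolding mat_fc_def by (rule someI)
  then obtain V d' where V: "unitary_mat n V" and AV: "A = V * diag_of n d' * mat_adjoint V"
    and B: "mat_fc n f A = V * diag_of n (\<lambda>i. f (d' i)) * mat_adjoint V"
    by blast
  let ?D' = "diag_of n d'" and ?F' = "diag_of n (\<lambda>i. f (d' i))"
  define U' V' W where "U' = mat_adjoint U" and "V' = mat_adjoint V" and "W = U' * V"
  have c [simp]: "U \<in> carrier_mat n n" "V \<in> carrier_mat n n" "U' \<in> carrier_mat n n"
      "V' \<in> carrier_mat n n" "W \<in> carrier_mat n n"
  proof -
    show UV: "U \<in> carrier_mat n n" "V \<in> carrier_mat n n"
      using U V by (simp_all only: unitary_mat_def)
    show U'V': "U' \<in> carrier_mat n n" "V' \<in> carrier_mat n n"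
      unfolding U'_def V'_def using UV by (auto intro!: carrier_matI)
    show "W \<in> carrier_mat n n"
      unfolding W_def using UV U'V' by simp
  qed
  have inv: "U * U' = 1\<^sub>m n" "V * V' = 1\<^sub>m n"
    using U V by (simp_all only: unitary_mat_def U'_def V'_def)
  have inv': "U' * U = 1\<^sub>m n" "V' * V = 1\<^sub>m n"
    using mat_mult_left_right_inverse inv c by blast+
  have eq: "U * ?D * U' = V * ?D' * V'"
    using A AV by (simp add: U'_def V'_def)
  have intertwine: "?D * W = W * ?D'"
  proof -
    have "?D * W = (U' * U) * ?D * (U' * V)"
      by (simp add: inv' W_def left_mult_one_mat[of _ n n])
    also have "\<dots> = U' * (U * ?D * U') * V"
      by (simp add: assoc_mult_mat[of _ n n _ n _ n] mult_carrier_mat[of _ n n _ n])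
    also have "\<dots> = U' * (V * ?D' * V') * V"
      by (simp only: eq)
    also have "\<dots> = W * ?D' * (V' * V)"
      by (simp add: assoc_mult_mat[of _ n n _ n _ n] mult_carrier_mat[of _ n n _ n] W_def)
    also have "\<dots> = W * ?D'"
      by (simp add: inv' right_mult_one_mat[of _ n n] mult_carrier_mat[of _ n n _ n])
    finally show ?thesis .
  qed
  have "?F * W = W * ?F'"
  proof (rule eq_matI)
    fix i j assume "i < dim_row (W * ?F')" "j < dim_col (W * ?F')"
    then have ij: "i < n" "j < n"
      using c(5) by (auto simp: diag_of_def)
    have "complex_of_real (d i) * W $$ (i, j) = W $$ (i, j) * complex_of_real (d' j)"
      by (rule trans[OF diag_of_mult_left[OF c(5) ij, of d, unfolded intertwine, symmetric]
            diag_of_mult_right[OF c(5) ij, of d']])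
    then have "W $$ (i, j) = 0 \<or> d i = d' j"
      by auto
    then show "(?F * W) $$ (i, j) = (W * ?F') $$ (i, j)"
      using diag_of_mult_left[OF c(5) ij, of "\<lambda>i. f (d i)"]
        diag_of_mult_right[OF c(5) ij, of "\<lambda>i. f (d' i)"] by auto
  qed (use carrier_matD[OF c(5)] in \<open>simp_all add: diag_of_def\<close>)
  then have FW: "U * (?F * W) * V' = U * (W * ?F') * V'"
    by simp
  have "U * (?F * W) * V' = U * ?F * U' * (V * V')"
    by (simp add: assoc_mult_mat[of _ n n _ n _ n] mult_carrier_mat[of _ n n _ n] W_def)
  also have "\<dots> = U * ?F * U'"
    by (simp add: inv right_mult_one_mat[of _ n n] mult_carrier_mat[of _ n n _ n])
  finally have l: "U * (?F * W) * V' = U * ?F * U'" .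
  have "U * (W * ?F') * V' = (U * U') * V * ?F' * V'"
    by (simp add: assoc_mult_mat[of _ n n _ n _ n] mult_carrier_mat[of _ n n _ n] W_def)
  also have "\<dots> = V * ?F' * V'"
    by (simp add: inv left_mult_one_mat[of _ n n])
  finally show ?thesis
    using B FW l by (simp add: U'_def V'_def)
qed

section \<open>Real symmetric 2 by 2 matrices and rotated diagonal matrices\<close>

definition sym_mat :: "real \<Rightarrow> real \<Rightarrow> real \<Rightarrow> complex mat" where
  "sym_mat p q r = mat 2 2 (\<lambda>(i, j). complex_of_real (if i \<noteq> j then q else if i = 0 then p else r))"

lemma less_two_iff: "i < 2 \<longleftrightarrow> i = 0 \<or> i = Suc 0"
  by auto

lemma herm_sym_mat: "herm_mat 2 (sym_mat p q r)"
  unfolding herm_mat_def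
  by (intro conjI eq_matI) (auto simp: sym_mat_def)

text \<open>The Hermitian form of \<open>sym_mat p q r\<close> at the complex vector
  \<open>(a, b)\<close>, expanded into real and imaginary parts.\<close>

definition quad_form :: "real \<Rightarrow> real \<Rightarrow> real \<Rightarrow> complex \<Rightarrow> complex \<Rightarrow> real" where
  "quad_form p q r a b = p * ((Re a)\<^sup>2 + (Im a)\<^sup>2) + 2 * q * (Re a * Re b + Im a * Im b) + r * ((Re b)\<^sup>2 + (Im b)\<^sup>2)"

lemma quad_form_complete_square:
  "p * quad_form p q r a b = (p * Re a + q * Re b)\<^sup>2 + (p * Im a + q * Im b)\<^sup>2
     + (p * r - q\<^sup>2) * ((Re b)\<^sup>2 + (Im b)\<^sup>2)"
  by (simp add: quad_form_def power2_eq_square algebra_simps)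

lemma quad_form_nonneg:
  assumes "p > 0" "q\<^sup>2 \<le> p * r"
  shows "0 \<le> quad_form p q r a b"
proof -
  have "0 \<le> p * quad_form p q r a b"
    unfolding quad_form_complete_square using assms by simp
  then show ?thesis
    using assms by (simp add: zero_le_mult_iff)
qed

lemma quad_form_pos:
  assumes "p > 0" "q\<^sup>2 < p * r" "a \<noteq> 0 \<or> b \<noteq> 0"
  shows "0 < quad_form p q r a b"
proof -
  have "0 < p * quad_form p q r a b"
  proof (cases "b = 0")
    case True
    then show ?thesis
      using assms by (auto simp: quad_form_complete_square complex_eq_iff sum_power2_gt_zero_iff)
  next
    case False
    then have "(Re b)\<^sup>2 + (Im b)\<^sup>2 > 0"
      by (simp add: complex_eq_iff sum_power2_gt_zero_iff)
    then show ?thesis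
      unfolding quad_form_complete_square using assms by (intro add_nonneg_pos) auto
  qed
  then show ?thesis
    using assms by (simp add: zero_less_mult_iff)
qed

lemma sym_mat_form:
  assumes "v \<in> carrier_vec 2"
  shows "Re ((sym_mat p q r *\<^sub>v v) \<bullet>c v) = quad_form p q r (v $ 0) (v $ 1)"
  using assms
  by (simp add: scalar_prod_def sym_mat_def quad_form_def numeral_2_eq_2 power2_eq_square algebra_simps)

lemma sym_mat_diff: "sym_mat p' q' r' - sym_mat p q r = sym_mat (p' - p) (q' - q) (r' - r)"
  by (rule eq_matI) (auto simp: sym_mat_def)

lemma pd_sym_mat:
  assumes "p > 0" "q\<^sup>2 < p * r"
  shows "pd_mat 2 (sym_mat p q r)"
  unfolding pd_mat_def
proof (intro conjI ballI impI herm_sym_mat)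
  fix v :: "complex vec" assume v: "v \<in> carrier_vec 2" "v \<noteq> 0\<^sub>v 2"
  then have "v $ 0 \<noteq> 0 \<or> v $ 1 \<noteq> 0"
    by (auto intro!: eq_vecI simp: less_two_iff)
  then show "0 < Re ((sym_mat p q r *\<^sub>v v) \<bullet>c v)"
    unfolding sym_mat_form[OF v(1)] by (rule quad_form_pos[OF assms])
qed

lemma loewner_le_sym_matI:
  assumes "p < p'" "(q' - q)\<^sup>2 \<le> (p' - p) * (r' - r)"
  shows "loewner_le 2 (sym_mat p q r) (sym_mat p' q' r')"
  unfolding loewner_le_def sym_mat_diff
  using assms by (auto simp: herm_sym_mat sym_mat_form intro!: quad_form_nonneg)

lemma loewner_le_sym_matD:
  assumes "loewner_le 2 (sym_mat p q r) (sym_mat p' q' r')"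
  shows "p \<le> p'" "r \<le> r'"
proof -
  have *: "0 \<le> quad_form (p' - p) (q' - q) (r' - r) (v $ 0) (v $ 1)" if "v \<in> carrier_vec 2" for v
    using assms that unfolding loewner_le_def sym_mat_diff by (simp add: sym_mat_form)
  show "p \<le> p'" "r \<le> r'"
    using *[of "unit_vec 2 0"] *[of "unit_vec 2 1"] by (simp_all add: quad_form_def)
qed

text \<open>The symmetric matrix with eigenvalue \<open>a\<close> at \<open>(sqrt (1 - \<sigma>), sqrt \<sigma>)\<close> and \<open>b\<close> on its complement.\<close>

definition rot_mat :: "real \<Rightarrow> real \<Rightarrow> real \<Rightarrow> complex mat" where
  "rot_mat \<sigma> a b = sym_mat (a * (1 - \<sigma>) + b * \<sigma>) ((a - b) * (sqrt (1 - \<sigma>) * sqrt \<sigma>)) (a * \<sigma> + b * (1 - \<sigma>))"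

lemma mat_fc_rot_mat:
  assumes "0 \<le> \<sigma>" "\<sigma> \<le> 1"
  shows "mat_fc 2 f (rot_mat \<sigma> a b) = rot_mat \<sigma> (f a) (f b)"
proof -
  define c s where "c = sqrt (1 - \<sigma>)" and "s = sqrt \<sigma>"
  have cs: "c * c = 1 - \<sigma>" "s * s = \<sigma>"
    using assms by (simp_all add: c_def s_def)
  \<comment> \<open>A rotation whose columns are the eigenvectors \<open>(c, s)\<close> for the
    first eigenvalue and \<open>(- s, c)\<close> for the second.\<close>
  define u where "u = (\<lambda>i j::nat. if i = j then c else if i = 0 then - s else s)"
  define U where "U = mat 2 2 (\<lambda>(i, j). complex_of_real (u i j))"
  have Uc: "U \<in> carrier_mat 2 2"
    by (simp add: U_def)
  have entry: "(U * diag_of 2 d * mat_adjoint U) $$ (i, j)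
      = complex_of_real (u i 0 * d 0 * u j 0 + u i 1 * d 1 * u j 1)"
    if "i < 2" "j < 2" for d i j
  proof -
    have "(U * diag_of 2 d * mat_adjoint U) $$ (i, j)
        = (\<Sum>k\<in>{0..<2}. (U * diag_of 2 d) $$ (i, k) * mat_adjoint U $$ (k, j))"
      using that by (simp add: scalar_prod_def U_def diag_of_def)
    also have "\<dots> = (\<Sum>k\<in>{0..<2}. complex_of_real (u i k * d k * u j k))"
      using that Uc by (intro sum.cong) (simp_all add: diag_of_mult_right, simp add: U_def)
    finally show ?thesis
      by (simp add: numeral_2_eq_2)
  qed
  have R: "rot_mat \<sigma> x y = U * diag_of 2 (\<lambda>i. if i = 0 then x else y) * mat_adjoint U" for x y
  proof (rule eq_matI)
    fix i j assume "i < dim_row (U * diag_of 2 (\<lambda>i. if i = 0 then x else y) * mat_adjoint U)"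
      "j < dim_col (U * diag_of 2 (\<lambda>i. if i = 0 then x else y) * mat_adjoint U)"
    then have ij: "i < 2" "j < 2"
      using Uc by auto
    have sq: "w * z * w = z * (w * w)" for w z :: real
      by simp
    have "c * x * c + s * y * s = x * (1 - \<sigma>) + y * \<sigma>" "s * x * s + c * y * c = x * \<sigma> + y * (1 - \<sigma>)"
      by (simp_all only: sq cs)
    then show "rot_mat \<sigma> x y $$ (i, j) = (U * diag_of 2 (\<lambda>i. if i = 0 then x else y) * mat_adjoint U) $$ (i, j)"
      unfolding entry[OF ij] rot_mat_def c_def[symmetric] s_def[symmetric] sym_mat_def left_diff_distrib
      using ij by (auto simp: less_two_iff u_def left_diff_distrib mult_ac simp del: of_real_add of_real_diff of_real_mult)
  qed (use Uc in \<open>auto simp: rot_mat_def sym_mat_def\<close>)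
  have U: "unitary_mat 2 U"
    unfolding unitary_mat_def
  proof (intro conjI Uc)
    \<comment> \<open>Unitarity is the diagonalisation formula \<open>R\<close> for both eigenvalues
      equal to 1.\<close>
    have "U * diag_of 2 (\<lambda>i. 1) * mat_adjoint U = rot_mat \<sigma> 1 1"
      using R[of 1 1] by simp
    moreover have "diag_of 2 (\<lambda>i. 1) = 1\<^sub>m 2"
      by (rule eq_matI) (auto simp: diag_of_def)
    moreover have "rot_mat \<sigma> 1 1 = 1\<^sub>m 2"
      by (rule eq_matI) (auto simp: rot_mat_def sym_mat_def)
    ultimately show "U * mat_adjoint U = 1\<^sub>m 2"
      using Uc by simp
  qed
  show ?thesis
    unfolding R by (subst mat_fc_unitary[OF U refl]) (simp add: if_distrib)
qed

lemma pd_rot_mat: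
  assumes "0 \<le> \<sigma>" "\<sigma> < 1" "a > 0" "b > 0"
  shows "pd_mat 2 (rot_mat \<sigma> a b)"
  unfolding rot_mat_def
proof (rule pd_sym_mat)
  show "0 < a * (1 - \<sigma>) + b * \<sigma>"
    using assms by (simp add: add_pos_nonneg)
  have "((a - b) * (sqrt (1 - \<sigma>) * sqrt \<sigma>))\<^sup>2 = (a - b)\<^sup>2 * ((1 - \<sigma>) * \<sigma>)"
    using assms by (simp add: power_mult_distrib)
  also have "\<dots> = (a * (1 - \<sigma>) + b * \<sigma>) * (a * \<sigma> + b * (1 - \<sigma>)) - a * b"
    by (simp add: power2_eq_square algebra_simps)
  finally show "((a - b) * (sqrt (1 - \<sigma>) * sqrt \<sigma>))\<^sup>2 < (a * (1 - \<sigma>) + b * \<sigma>) * (a * \<sigma> + b * (1 - \<sigma>))"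
    using assms by simp
qed

section \<open>Strict monotonicity of nonconstant operator monotone functions\<close>

lemma operator_monotone_rot:
  assumes "operator_monotone f" "0 \<le> \<sigma>" "\<sigma> < 1" "0 \<le> \<tau>" "\<tau> < 1" "a > 0" "b > 0" "a' > 0" "b' > 0"
    and "loewner_le 2 (rot_mat \<sigma> a b) (rot_mat \<tau> a' b')"
  shows "loewner_le 2 (rot_mat \<sigma> (f a) (f b)) (rot_mat \<tau> (f a') (f b'))"
proof -
  have "pd_mat 2 (rot_mat \<sigma> a b)" "pd_mat 2 (rot_mat \<tau> a' b')"
    by (rule pd_rot_mat[OF assms(2,3,6,7)], rule pd_rot_mat[OF assms(4,5,8,9)])
  then have "loewner_le 2 (mat_fc 2 f (rot_mat \<sigma> a b)) (mat_fc 2 f (rot_mat \<tau> a' b'))"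
    using assms(1,10) unfolding operator_monotone_def by blast
  then show ?thesis
    using assms(2-5) by (simp add: mat_fc_rot_mat)
qed

lemma operator_monotone_mono:
  assumes "operator_monotone f" "0 < s" "s < t"
  shows "f s \<le> f t"
proof -
  have "loewner_le 2 (rot_mat 0 s s) (rot_mat 0 t t)"
    unfolding rot_mat_def using assms(3) by (intro loewner_le_sym_matI) simp_all
  then have "loewner_le 2 (rot_mat 0 (f s) (f s)) (rot_mat 0 (f t) (f t))"
    using assms(2,3) by (intro operator_monotone_rot[OF assms(1)]) simp_all
  then show ?thesis
    unfolding rot_mat_def by (drule_tac loewner_le_sym_matD(1)) simp
qed

lemma small_rotation_exists:
  fixes \<delta> C :: real
  assumes "\<delta> > 0"
  obtains \<sigma> where "0 < \<sigma>" "\<sigma> < 1" "C * \<sigma> \<le> \<delta>"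
proof -
  have "C * min (1 / 2) (\<delta> / (\<bar>C\<bar> + 1)) \<le> \<bar>C\<bar> * (\<delta> / (\<bar>C\<bar> + 1))"
    using assms by (intro mult_mono) auto
  also have "\<dots> \<le> \<delta>"
    using assms by (simp add: field_simps)
  finally show ?thesis
    using assms by (intro that[of "min (1 / 2) (\<delta> / (\<bar>C\<bar> + 1))"]) auto
qed

text \<open>Flatness on \<open>[s, t]\<close> is incompatible with a smaller value to the left of \<open>s\<close>: a slight rotation of
  the eigenvector of the larger eigenvalue lowers a diagonal entry of \<open>f\<close> of the larger matrix.\<close>

lemma operator_monotone_flat_left:
  assumes f: "operator_monotone f" and st: "0 < s" "s < t" "f s = f t" and a: "0 < a" "a < s"
  shows "f a \<ge> f s"
proof (rule ccontr)
  assume lt: "\<not> f a \<ge> f s"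
  \<comment> \<open>The bound makes the determinant of the difference of the two matrices below
    nonnegative: its squared off-diagonal entry is at most
    \<open>(t - a)\<^sup>2 * \<sigma>\<close>, its upper left entry at least \<open>a / 2\<close>,
    and its lower right entry is \<open>t - s - (t - a) * \<sigma>\<close>. Taking
    \<open>a / 2\<close> in the smaller matrix keeps the upper left entry away from 0 as
    \<open>\<sigma>\<close> shrinks.\<close>
  obtain \<sigma> where \<sigma>: "0 < \<sigma>" "\<sigma> < 1" "((t - a)\<^sup>2 + a / 2 * (t - a)) * \<sigma> \<le> a / 2 * (t - s)"
    using st a by (auto intro: small_rotation_exists[of "a / 2 * (t - s)" "(t - a)\<^sup>2 + a / 2 * (t - a)"])
  have "loewner_le 2 (rot_mat 0 (a / 2) s) (rot_mat \<sigma> a t)"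
    unfolding rot_mat_def
  proof (rule loewner_le_sym_matI)
    have d: "a * (1 - \<sigma>) + t * \<sigma> - a / 2 \<ge> a / 2"
      using \<sigma> st a mult_right_mono[of a t \<sigma>] by (simp add: algebra_simps)
    then show "a / 2 * (1 - 0) + s * 0 < a * (1 - \<sigma>) + t * \<sigma>"
      using a by simp
    have "((a - t) * (sqrt (1 - \<sigma>) * sqrt \<sigma>))\<^sup>2 = (t - a)\<^sup>2 * ((1 - \<sigma>) * \<sigma>)"
      using \<sigma> by (simp add: power_mult_distrib power2_commute)
    also have "\<dots> \<le> (t - a)\<^sup>2 * \<sigma>"
      using \<sigma> by (intro mult_left_mono) (auto simp: mult_le_cancel_right1)
    also have le: "\<dots> \<le> a / 2 * (t - s - (t - a) * \<sigma>)"
    proof -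
      have "a / 2 * (t - s - (t - a) * \<sigma>) = a / 2 * (t - s) - (a / 2 * (t - a)) * \<sigma>"
        by (simp add: field_simps)
      then show ?thesis
        using \<sigma>(3) by (simp only: distrib_right)
    qed
    also have "\<dots> \<le> (a * (1 - \<sigma>) + t * \<sigma> - a / 2) * (t - s - (t - a) * \<sigma>)"
    proof (rule mult_right_mono[OF d])
      have "0 \<le> a / 2 * (t - s - (t - a) * \<sigma>)"
        using le \<sigma> by (intro order_trans[OF _ le]) simp
      then show "0 \<le> t - s - (t - a) * \<sigma>"
        using a by (simp add: zero_le_mult_iff)
    qed
    finally show "((a - t) * (sqrt (1 - \<sigma>) * sqrt \<sigma>) - (a / 2 - s) * (sqrt (1 - 0) * sqrt 0))\<^sup>2
      \<le> (a * (1 - \<sigma>) + t * \<sigma> - (a / 2 * (1 - 0) + s * 0)) * (a * \<sigma> + t * (1 - \<sigma>) - (a / 2 * 0 + s * (1 - 0)))"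
      by (simp add: algebra_simps)
  qed
  then have "loewner_le 2 (rot_mat 0 (f (a / 2)) (f s)) (rot_mat \<sigma> (f a) (f t))"
    using \<sigma>(1,2) st(1,2) a by (intro operator_monotone_rot[OF f]) simp_all
  \<comment> \<open>The lower right entries are compared. Since \<open>f t = f s\<close>, a smaller
    \<open>f a\<close> would pull the convex combination on the right below
    \<open>f s\<close>.\<close>
  then have "f s \<le> f a * \<sigma> + f t * (1 - \<sigma>)"
    unfolding rot_mat_def by (drule_tac loewner_le_sym_matD(2)) simp
  then have "0 \<le> (f a - f s) * \<sigma>"
    using st by (simp add: algebra_simps)
  then show False
    using lt \<sigma> by (simp add: zero_le_mult_iff)
qed

text \<open>The mirror image of the preceding argument. Now the smaller matrix is rotated, which
  mixes some of \<open>f b\<close> into its upper left entry, while that entry of \<open>f\<close>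
  of the larger matrix remains \<open>f t = f s\<close>. The eigenvalue \<open>b + 1\<close> leaves
  room of size at least 1 in the lower right corner.\<close>

lemma operator_monotone_flat_right:
  assumes f: "operator_monotone f" and st: "0 < s" "s < t" "f s = f t" and b: "t < b"
  shows "f b \<le> f t"
proof (rule ccontr)
  assume lt: "\<not> f b \<le> f t"
  obtain \<sigma> where \<sigma>: "0 < \<sigma>" "\<sigma> < 1" "((b - s)\<^sup>2 + (b - s)) * \<sigma> \<le> t - s"
    using st by (auto intro: small_rotation_exists[of "t - s" "(b - s)\<^sup>2 + (b - s)"])
  have "loewner_le 2 (rot_mat \<sigma> s b) (rot_mat 0 t (b + 1))"
    unfolding rot_mat_def
  proof (rule loewner_le_sym_matI)
    have d: "b + 1 - (s * \<sigma> + b * (1 - \<sigma>)) \<ge> 1"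
      using \<sigma> st b mult_right_mono[of s b \<sigma>] by (simp add: algebra_simps)
    have "(b - s)\<^sup>2 * \<sigma> > 0"
      using \<sigma> st b by simp
    moreover have "(b - s)\<^sup>2 * \<sigma> \<le> t - s - (b - s) * \<sigma>"
      using \<sigma>(3) by (simp add: algebra_simps)
    ultimately have p: "t - s - (b - s) * \<sigma> > 0"
      by linarith
    then show "s * (1 - \<sigma>) + b * \<sigma> < t * (1 - 0) + (b + 1) * 0"
      by (simp add: algebra_simps)
    have "((s - b) * (sqrt (1 - \<sigma>) * sqrt \<sigma>))\<^sup>2 = (b - s)\<^sup>2 * ((1 - \<sigma>) * \<sigma>)"
      using \<sigma> by (simp add: power_mult_distrib power2_commute)
    also have "\<dots> \<le> (b - s)\<^sup>2 * \<sigma>"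
      using \<sigma> by (intro mult_left_mono) (auto simp: mult_le_cancel_right1)
    also have "\<dots> \<le> (t - s - (b - s) * \<sigma>) * 1"
      using \<sigma>(3) by (simp add: algebra_simps)
    also have "\<dots> \<le> (t - s - (b - s) * \<sigma>) * (b + 1 - (s * \<sigma> + b * (1 - \<sigma>)))"
      using p d by (intro mult_left_mono) auto
    finally have "((s - b) * (sqrt (1 - \<sigma>) * sqrt \<sigma>))\<^sup>2
      \<le> (t - s - (b - s) * \<sigma>) * (b + 1 - (s * \<sigma> + b * (1 - \<sigma>)))" .
    moreover have "t - s - (b - s) * \<sigma> = t * (1 - 0) + (b + 1) * 0 - (s * (1 - \<sigma>) + b * \<sigma>)"
      by (simp add: algebra_simps)
    ultimately show "((t - (b + 1)) * (sqrt (1 - 0) * sqrt 0) - (s - b) * (sqrt (1 - \<sigma>) * sqrt \<sigma>))\<^sup>2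
      \<le> (t * (1 - 0) + (b + 1) * 0 - (s * (1 - \<sigma>) + b * \<sigma>)) * (t * 0 + (b + 1) * (1 - 0) - (s * \<sigma> + b * (1 - \<sigma>)))"
      by simp
  qed
  then have "loewner_le 2 (rot_mat \<sigma> (f s) (f b)) (rot_mat 0 (f t) (f (b + 1)))"
    using \<sigma>(1,2) st(1,2) b by (intro operator_monotone_rot[OF f]) simp_all
  then have "f s * (1 - \<sigma>) + f b * \<sigma> \<le> f t"
    unfolding rot_mat_def by (drule_tac loewner_le_sym_matD(1)) simp
  then have "(f b - f t) * \<sigma> \<le> 0"
    using st by (simp add: algebra_simps)
  then show False
    using lt \<sigma> by (simp add: mult_le_0_iff)
qed

text \<open>By the two flatness lemmas, equality at two points spreads to both sides, so the
  function would be constant on the positive half-line.\<close>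

lemma operator_monotone_strict:
  assumes f: "operator_monotone f" and nc: "0 < u" "0 < v" "f u \<noteq> f v"
  shows "strict_mono_on {0<..} f"
proof (rule strict_mono_onI)
  fix s t :: real assume "s \<in> {0<..}" "t \<in> {0<..}" and st: "s < t"
  then have s: "0 < s"
    by simp
  show "f s < f t"
  proof (rule ccontr)
    assume "\<not> f s < f t"
    then have eq: "f s = f t"
      using operator_monotone_mono[OF f s st] by simp
    have "f x = f s" if "x > 0" for x
    proof -
      consider "x < s" | "s \<le> x" "x \<le> t" | "t < x"
        by linarith
      then show ?thesis
      proof cases
        case 1
        then show ?thesis
          using operator_monotone_flat_left[OF f s st eq that] operator_monotone_mono[OF f that, of s] by simp
      next
        case 2
        then show ?thesis
          using operator_monotone_mono[OF f s, of x] operator_monotone_mono[OF f that, of t] eq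
          by fastforce
      next
        case 3
        then show ?thesis
          using operator_monotone_flat_right[OF f s st eq, of x] operator_monotone_mono[OF f, of t x] s st eq by simp
      qed
    qed
    then show False
      using nc by metis
  qed
qed

subsection \<open>The functional equation\<close>

text \<open>The alternative may depend on the triple and has to be made uniform. Suppose
  \<open>x\<close>, \<open>y\<close>, \<open>z\<close> are not collinear for \<open>u\<close>, hence
  collinear for \<open>v\<close>. A point \<open>t\<close> off their \<open>v\<close>-line would be
  \<open>u\<close>-collinear with \<open>x\<close>, \<open>y\<close> and with \<open>x\<close>,
  \<open>z\<close>, which would put \<open>x\<close>, \<open>y\<close>, \<open>z\<close> on one
  \<open>u\<close>-line.\<close>

lemma triple_dichotomy_imp_affine:
  fixes u v :: "real \<Rightarrow> real" and S :: "real set"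
  defines "collin \<equiv> \<lambda>\<phi> x y z. (\<phi> y - \<phi> x) * (z - x) = (\<phi> z - \<phi> x) * (y - x)"
  assumes dich: "\<And>x y z. x \<in> S \<Longrightarrow> y \<in> S \<Longrightarrow> z \<in> S \<Longrightarrow> x \<noteq> y \<Longrightarrow> x \<noteq> z \<Longrightarrow> y \<noteq> z
      \<Longrightarrow> collin u x y z \<or> collin v x y z"
  shows "(\<exists>a b. \<forall>x\<in>S. u x = a * x + b) \<or> (\<exists>a b. \<forall>x\<in>S. v x = a * x + b)"
proof -
  have affine: "\<exists>a b. \<forall>x\<in>S. \<phi> x = a * x + b" if c: "\<And>x. x \<in> S \<Longrightarrow> collin \<phi> p q x" "p \<noteq> q" for \<phi> p q
  proof -
    define s where "s = (\<phi> q - \<phi> p) / (q - p)"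
    have s: "\<phi> q - \<phi> p = s * (q - p)"
      using c(2) by (simp add: s_def)
    have "\<phi> x = s * x + (\<phi> p - s * p)" if "x \<in> S" for x
    proof -
      have "(s * (x - p)) * (q - p) = (\<phi> x - \<phi> p) * (q - p)"
        using c(1)[OF that] by (simp add: collin_def s mult_ac)
      then have "s * (x - p) = \<phi> x - \<phi> p"
        using c(2) by simp
      then show ?thesis
        by (simp add: right_diff_distrib)
    qed
    then show ?thesis
      by blast
  qed
  show ?thesis
  proof (cases "\<forall>x\<in>S. \<forall>y\<in>S. \<forall>z\<in>S. collin u x y z")
    case True
    show ?thesis
    proof (cases "\<exists>p\<in>S. \<exists>q\<in>S. p \<noteq> q")
      case True
      then show ?thesis
        using \<open>\<forall>x\<in>S. _\<close> affine[of u] by blast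
    next
      case False
      then obtain p where "S \<subseteq> {p}"
        by blast
      then have "\<forall>x\<in>S. u x = 0 * x + u p"
        by auto
      then show ?thesis
        by blast
    qed
  next
    case False
    then obtain x y z where S: "x \<in> S" "y \<in> S" "z \<in> S" and nu: "\<not> collin u x y z"
      by blast
    have ne: "x \<noteq> y" "x \<noteq> z" "y \<noteq> z"
      using nu by (auto simp: collin_def)
    have v: "collin v x y z"
      using dich S ne nu by blast
    have "collin v x y t" if t: "t \<in> S" for t
    proof (rule ccontr)
      assume nv: "\<not> collin v x y t"
      have "t \<noteq> x" "t \<noteq> y" "t \<noteq> z"
        using nv v by (auto simp: collin_def)
      have "\<not> collin v x z t"
      proof
        assume "collin v x z t"
        then have "(z - x) * ((v y - v x) * (t - x) - (v t - v x) * (y - x)) = 0"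
          \<comment> \<open>qualified, because the method of HOL-Algebra has the same short name\<close>
          using v unfolding collin_def by Groebner_Basis.algebra
        then show False
          using nv ne by (simp add: collin_def)
      qed
      then have "collin u x y t" "collin u x z t"
        using dich S t ne nv \<open>t \<noteq> x\<close> \<open>t \<noteq> y\<close> \<open>t \<noteq> z\<close> by blast+
      then have "(t - x) * ((u y - u x) * (z - x) - (u z - u x) * (y - x)) = 0"
        unfolding collin_def by Groebner_Basis.algebra
      then show False
        using nu \<open>t \<noteq> x\<close> by (simp add: collin_def)
    qed
    then show ?thesis
      using affine[of v x y] ne by blast
  qed
qed

lemma chord_equation_imp_affine:
  fixes h m :: "real \<Rightarrow> real"
  assumes h: "\<And>x. x > 0 \<Longrightarrow> h x > 0" and m: "\<And>x. x > 0 \<Longrightarrow> m x > 0"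
    and minj: "inj_on m {0<..}"
    and k: "k \<noteq> 0"
    and eq: "\<And>x y. x > 0 \<Longrightarrow> y > 0 \<Longrightarrow>
      k * (m x * y - m y * x) * (h y - h x) = (m x * h y - m y * h x) * (y - x)"
  shows "(\<exists>a b. \<forall>x>0. h x = a * x + b) \<or> (\<exists>a b. \<forall>x>0. x / h x = a * x + b)"
proof (cases "k = 1")
  case True
  have "h x = h 1 * x" if "x > 0" for x
  proof (cases "x = 1")
    case False
    \<comment> \<open>For \<open>k = 1\<close> the equation at the points \<open>x\<close> and 1
      factors; injectivity of \<open>m\<close> removes the first factor.\<close>
    have "(m x - m 1) * (h 1 * x - h x) = 0"
      using eq[OF that, of 1] True by (simp add: algebra_simps)
    moreover have "m x \<noteq> m 1"
      using minj that False by (auto simp: inj_on_def)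
    ultimately show ?thesis
      by simp
  qed simp
  then show ?thesis
    by (metis add.right_neutral)
next
  case False
  define w where "w = (\<lambda>x. x / h x)"
  have "(\<exists>a b. \<forall>x\<in>{0<..}. h x = a * x + b) \<or> (\<exists>a b. \<forall>x\<in>{0<..}. w x = a * x + b)"
  proof (rule triple_dichotomy_imp_affine)
    fix x y z :: real
    assume "x \<in> {0<..}" "y \<in> {0<..}" "z \<in> {0<..}" and ne: "x \<noteq> y" "x \<noteq> z" "y \<noteq> z"
    then have pos: "x > 0" "y > 0" "z > 0"
      by auto
    define X Y Z where "X = h x" and "Y = h y" and "Z = h z"
    have XYZ: "X > 0" "Y > 0" "Z > 0"
      using h pos by (auto simp: X_def Y_def Z_def)
    \<comment> \<open>Each pair of points determines a ratio of two values of \<open>m\<close>.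
      Multiplying the three equations cyclically eliminates \<open>m\<close>.\<close>
    have "m x * (Y * (y - x) - k * y * (Y - X)) = m y * (X * (y - x) - k * x * (Y - X))"
      "m y * (Z * (z - y) - k * z * (Z - Y)) = m z * (Y * (z - y) - k * y * (Z - Y))"
      "m z * (X * (x - z) - k * x * (X - Z)) = m x * (Z * (x - z) - k * z * (X - Z))"
      using eq[OF pos(1,2)] eq[OF pos(2,3)] eq[OF pos(3,1)]
      by (simp_all add: X_def Y_def Z_def algebra_simps)
    then have "(m x * m y * m z) * ((Y * (y - x) - k * y * (Y - X)) * (Z * (z - y) - k * z * (Z - Y)) * (X * (x - z) - k * x * (X - Z)))
      = (m x * m y * m z) * ((X * (y - x) - k * x * (Y - X)) * (Y * (z - y) - k * y * (Z - Y)) * (Z * (x - z) - k * z * (X - Z)))"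
      by Groebner_Basis.algebra
    then have "(Y * (y - x) - k * y * (Y - X)) * (Z * (z - y) - k * z * (Z - Y)) * (X * (x - z) - k * x * (X - Z))
      = (X * (y - x) - k * x * (Y - X)) * (Y * (z - y) - k * y * (Z - Y)) * (Z * (x - z) - k * z * (X - Z))"
      using m[OF pos(1)] m[OF pos(2)] m[OF pos(3)] by simp
    \<comment> \<open>Up to sign, the left side is the difference of the two products. The last
      factor is the collinearity expression of \<open>w\<close>, multiplied by
      \<open>X * Y * Z\<close>.\<close>
    then have "k * (k - 1) * ((Y - X) * (z - x) - (Z - X) * (y - x))
        * ((y * X * Z - x * Y * Z) * (z - x) - (z * X * Y - x * Y * Z) * (y - x)) = 0"
      by Groebner_Basis.algebra
    then have "(Y - X) * (z - x) = (Z - X) * (y - x)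
       \<or> (y * X * Z - x * Y * Z) * (z - x) = (z * X * Y - x * Y * Z) * (y - x)"
      using k False by simp
    moreover have "y * X * Z - x * Y * Z = (X * Y * Z) * (w y - w x)"
      "z * X * Y - x * Y * Z = (X * Y * Z) * (w z - w x)"
      using XYZ by (simp_all add: w_def field_simps flip: X_def Y_def Z_def)
    ultimately show "(h y - h x) * (z - x) = (h z - h x) * (y - x) \<or>
      (w y - w x) * (z - x) = (w z - w x) * (y - x)"
      using XYZ by (auto simp flip: X_def Y_def Z_def)
  qed
  then show ?thesis
    by (simp add: w_def Ball_def)
qed

text \<open>If \<open>h x = a * x\<close>, then \<open>a = 1\<close> gives the first alternative and
  \<open>a \<noteq> 1\<close> the second with \<open>c = a\<close>. Otherwise an affine
  \<open>h\<close> leads to the arithmetic mean and an affine \<open>x / h x\<close> to the harmonic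
  mean.\<close>

lemma mean_function_classification:
  fixes f h :: "real \<Rightarrow> real"
  assumes f_pos: "\<And>t. t > 0 \<Longrightarrow> f t > 0" and f_one: "f 1 = 1"
    and f_symm: "\<And>t. t > 0 \<Longrightarrow> t * f (1 / t) = f t"
    and f_inj: "inj_on f {0<..}"
    and h_pos: "\<And>t. t > 0 \<Longrightarrow> h t > 0" and h_inj: "inj_on h {0<..}"
    and scalar: "\<And>x y. x > 0 \<Longrightarrow> y > 0 \<Longrightarrow> h x * f (y / h x) = x * f (h y / x)"
    and K: "K \<noteq> 0"
    and chord: "\<And>x y. 0 < x \<Longrightarrow> x < y \<Longrightarrow>
      K * ((f (h 1 / x) - f (h 1 / y)) / (h 1 / x - h 1 / y))
        = (f (1 / h x) - f (1 / h y)) / (1 / h x - 1 / h y)"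
  shows "(\<forall>t>0. h t = t) \<or> (\<exists>c>0. c \<noteq> 1 \<and> (\<forall>t>0. f (c\<^sup>2 * t) = c * f t))
    \<or> (\<forall>t>0. f t = (1 + t) / 2) \<or> (\<forall>t>0. f t = 2 * t / (1 + t))"
proof -
  define d m k where "d = h 1" and "m = (\<lambda>x. f (h x))" and "k = K / d"
  have d: "d > 0"
    using h_pos by (simp add: d_def)
  have m_pos: "m x > 0" if "x > 0" for x
    using f_pos h_pos that by (simp add: m_def)
  have m1: "f (1 / h x) = m x / h x" if "x > 0" for x
    using f_symm[of "h x"] h_pos[OF that] by (simp add: m_def field_simps)
  have m2: "f (d / x) = m x / x" if "x > 0" for x
    using scalar[OF that, of 1] m1[OF that] h_pos[OF that] that by (simp add: d_def field_simps)
  have f_m: "f t = m (d / t) * t / d" if "t > 0" for t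
    using m2[of "d / t"] d that by simp
  have minj: "inj_on m {0<..}"
    unfolding m_def using f_inj h_inj h_pos by (auto simp: inj_on_def)
  have k: "k \<noteq> 0"
    using K d by (simp add: k_def)
  have E: "k * (m x * y - m y * x) * (h y - h x) = (m x * h y - m y * h x) * (y - x)"
    if xy: "x > 0" "x < y" for x y
  proof -
    have y: "y > 0" and hx: "h x > 0" and hy: "h y > 0" and hne: "h x \<noteq> h y"
      using xy h_pos inj_onD[OF h_inj, of x y] by auto
    have l: "(f (d / x) - f (d / y)) / (d / x - d / y) = (m x * y - m y * x) / (d * (y - x))"
    proof -
      have "f (d / x) - f (d / y) = (m x * y - m y * x) / (x * y)" "d / x - d / y = d * (y - x) / (x * y)"
        using xy y by (simp_all add: m2 field_simps)
      then show ?thesis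
        using xy y by simp
    qed
    have r: "(f (1 / h x) - f (1 / h y)) / (1 / h x - 1 / h y) = (m x * h y - m y * h x) / (h y - h x)"
    proof -
      have "f (1 / h x) - f (1 / h y) = (m x * h y - m y * h x) / (h x * h y)"
        "1 / h x - 1 / h y = (h y - h x) / (h x * h y)"
        using xy y hx hy by (simp_all add: m1 field_simps)
      then show ?thesis
        using hx hy by simp
    qed
    have "K * ((m x * y - m y * x) / (d * (y - x))) = (m x * h y - m y * h x) / (h y - h x)"
      using chord[OF xy] unfolding d_def[symmetric] l r .
    then show ?thesis
      using xy d hne by (simp add: k_def field_simps)
  qed
  have E: "k * (m x * y - m y * x) * (h y - h x) = (m x * h y - m y * h x) * (y - x)"
    if xy: "x > 0" "y > 0" for x y
    using E[of x y] E[of y x] that by (cases x y rule: linorder_cases) (auto simp: algebra_simps)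
  have linear: ?thesis if lin: "\<And>x. x > 0 \<Longrightarrow> h x = a * x" for a
  proof (cases "a = 1")
    case True
    then show ?thesis
      using lin by simp
  next
    case False
    have a: "a > 0"
      using lin[of 1] h_pos[of 1] by simp
    have "f (a\<^sup>2 * t) = a * f t" if "t > 0" for t
      \<comment> \<open>At these points the two sides of the scalar equation are
        \<open>a * f t\<close> and \<open>f (h (a * t))\<close>.\<close>
      using scalar[of 1 "a * t"] a that by (simp add: lin power2_eq_square mult.assoc)
    then show ?thesis
      using a False by blast
  qed
  have "(\<exists>a b. \<forall>x>0. h x = a * x + b) \<or> (\<exists>a b. \<forall>x>0. x / h x = a * x + b)"
    by (rule chord_equation_imp_affine[OF h_pos m_pos minj k E])
  then show ?thesis
  proof (elim disjE exE)
    fix a b assume ab: "\<forall>x>0. h x = a * x + b"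
    show ?thesis
    proof (cases "b = 0")
      case True
      then show ?thesis
        using linear ab by simp
    next
      case False
      \<comment> \<open>For affine \<open>h\<close>, the difference \<open>h y - h x\<close> is
        \<open>a * (y - x)\<close>, and the factor \<open>y - x\<close> cancels in \<open>E\<close>.
        Thus \<open>m\<close> is proportional to an affine function.\<close>
      have l: "m x * (a * (1 - k) * y + b) = m y * (a * (1 - k) * x + b)" if "x > 0" "y > 0" for x y
      proof (cases "x = y")
        case ne: False
        have "(m x * (a * (1 - k) * y + b)) * (y - x) = (m y * (a * (1 - k) * x + b)) * (y - x)"
          using E[OF that] ab that by (simp add: algebra_simps)
        then show ?thesis
          using ne by simp
      qed simp
      \<comment> \<open>If it vanished, \<open>l\<close> at 1 and 2 would make
        \<open>a * (1 - k) * 2 + b\<close> vanish as well, forcing \<open>b = 0\<close>.\<close>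
      have "a * (1 - k) + b \<noteq> 0"
        using l[of 1 2] m_pos[of 1] m_pos[of 2] False by auto
      define \<alpha> \<beta> \<gamma> where "\<alpha> = m 1 * (a * (1 - k)) / (a * (1 - k) + b)"
        and "\<beta> = m 1 * b / (a * (1 - k) + b)" and "\<gamma> = \<beta> / d"
      have "m x = \<alpha> * x + \<beta>" if "x > 0" for x
      proof -
        have "m x = m 1 * (a * (1 - k) * x + b) / (a * (1 - k) + b)"
          using l[OF that, of 1] \<open>a * (1 - k) + b \<noteq> 0\<close> by (simp add: eq_divide_eq)
        then show ?thesis
          by (simp add: \<alpha>_def \<beta>_def distrib_left add_divide_distrib mult.assoc)
      qed
      \<comment> \<open>\<open>f_m\<close> turns the affine \<open>m\<close> into an affine
        \<open>f\<close>. The value at 1 and the symmetry at 2 then make both coefficients one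
        half.\<close>
      then have f: "f t = \<alpha> + \<gamma> * t" if "t > 0" for t
        using f_m[OF that] d that by (simp add: \<gamma>_def add_divide_distrib distrib_right)
      have "\<alpha> + \<gamma> = 1"
        using f[of 1] f_one by simp
      moreover have "\<alpha> = \<gamma>"
        using f_symm[of 2] f[of 2] f[of "1/2"] by simp
      ultimately have "f t = (1 + t) / 2" if "t > 0" for t
        using f[OF that] by (simp add: field_simps)
      then show ?thesis
        by blast
    qed
  next
    fix a b assume w: "\<forall>x>0. x / h x = a * x + b"
    have e: "a * x + b > 0" "h x = x / (a * x + b)" if "x > 0" for x
    proof -
      have "a * x + b = x / h x"
        using w that by simp
      then show "a * x + b > 0" "h x = x / (a * x + b)"
        using h_pos[OF that] that by simp_all
    qed
    show ?thesis
    proof (cases "a = 0")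
      case True
      then show ?thesis
        using linear[of "1 / b"] e by simp
    next
      case False
      \<comment> \<open>The same elimination with \<open>h x = x / (a * x + b)\<close>: now
        \<open>m x / x\<close> is a constant divided by an affine function.\<close>
      have l: "m x / x * (a * x + b * (1 - k)) = m y / y * (a * y + b * (1 - k))"
        if "x > 0" "y > 0" for x y
      proof (cases "x = y")
        case ne: False
        define p q where "p = a * x + b" and "q = a * y + b"
        have pq: "p > 0" "q > 0" "h x = x / p" "h y = y / q"
          using e that by (auto simp: p_def q_def)
        have "k * (m x * y - m y * x) * (y / q - x / p) = (m x * (y / q) - m y * (x / p)) * (y - x)"
          using E[OF that] pq by simp
        then have "(k * (m x * y - m y * x) * (y / q - x / p)) * (p * q)
            = ((m x * (y / q) - m y * (x / p)) * (y - x)) * (p * q)"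
          by simp
        moreover have "(y / q - x / p) * (p * q) = y * p - x * q"
          "(m x * (y / q) - m y * (x / p)) * (p * q) = m x * y * p - m y * x * q"
          using pq by (simp_all add: field_simps)
        ultimately have "k * (m x * y - m y * x) * (y * p - x * q) = (m x * y * p - m y * x * q) * (y - x)"
          by Groebner_Basis.algebra
        then have "(m x * y * (a * x + b * (1 - k))) * (y - x) = (m y * x * (a * y + b * (1 - k))) * (y - x)"
          unfolding p_def q_def by Groebner_Basis.algebra
        then have "m x * y * (a * x + b * (1 - k)) = m y * x * (a * y + b * (1 - k))"
          using ne by simp
        then have "(m x * (a * x + b * (1 - k))) / x = (m y * (a * y + b * (1 - k))) / y"
          using that by (simp only: frac_eq_eq mult_ac less_imp_neq[symmetric] simp_thms)
        then show ?thesis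
          by simp
      qed simp
      define C \<nu> where "C = m 1 * (a + b * (1 - k))" and "\<nu> = b * (1 - k)"
      have l1: "m x / x * (a * x + \<nu>) = C" if "x > 0" for x
        using l[OF that, of 1] by (simp add: C_def \<nu>_def)
      have "C \<noteq> 0"
      proof
        assume "C = 0"
        then have "a + \<nu> = 0" "a * 2 + \<nu> = 0"
          using l1[of 1] l1[of 2] m_pos[of 1] m_pos[of 2] by auto
        then show False
          using False by simp
      qed
      have f: "f t * (a * d + \<nu> * t) = C * t" if "t > 0" for t
      proof -
        have "f t * (a * (d / t) + \<nu>) = C"
          using l1[of "d / t"] m2[of "d / t"] d that by simp
        then have "f t * ((a * (d / t) + \<nu>) * t) = C * t"
          by simp
        then show ?thesis
          using that by (simp add: distrib_right)
      qed
      \<comment> \<open>Symmetry at 2 fixes \<open>\<nu>\<close> and the value at 1 fixes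
        \<open>C\<close> in \<open>f t = C * t / (a * d + \<nu> * t)\<close>.\<close>
      have "f 2 = 2 * f (1 / 2)"
        using f_symm[of 2] by simp
      then have "f 2 * (a * d + \<nu> * 2) = 2 * C" "f 2 * (a * d * 2 + \<nu>) = 2 * C"
        using f[of 2] f[of "1 / 2"] by (simp_all add: algebra_simps)
      then have "f 2 * (a * d + \<nu> * 2) = f 2 * (a * d * 2 + \<nu>)"
        by simp
      then have \<nu>: "\<nu> = a * d"
        using f_pos[of 2] by simp
      have C: "C = 2 * (a * d)"
        using f[of 1] f_one \<nu> by simp
      have "f t = 2 * t / (1 + t)" if "t > 0" for t
      proof -
        have "(a * d) * (f t * (1 + t)) = (a * d) * (2 * t)"
          using f[OF that] by (simp add: \<nu> C algebra_simps)
        then have "f t * (1 + t) = 2 * t"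
          using False d by simp
        then show ?thesis
          using that by (simp add: field_simps)
      qed
      then show ?thesis
        by blast
    qed
  qed
qed

subsection \<open>From operators to the functional equation\<close>

text \<open>By symmetry \<open>f t / t\<close> equals \<open>f (1 / t)\<close> and is nonincreasing.
  So \<open>f\<close> changes no faster than the line through the origin and
  \<open>(s, f s)\<close>.\<close>

lemma abs_diff_le_of_symmetric_mono:
  fixes f :: "real \<Rightarrow> real"
  assumes mono: "\<And>s t. 0 < s \<Longrightarrow> s < t \<Longrightarrow> f s \<le> f t"
    and symm: "\<And>t. t > 0 \<Longrightarrow> t * f (1 / t) = f t"
    and st: "0 < s" "0 < t"
  shows "\<bar>f t - f s\<bar> \<le> f s / s * \<bar>t - s\<bar>"
proof -
  have ratio: "f b / b \<le> f a / a" if "0 < a" "a < b" for a b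
  proof -
    have "f (1 / b) \<le> f (1 / a)"
      using that by (intro mono) (auto simp: frac_less2)
    then show ?thesis
      using symm[of a] symm[of b] that by (metis nonzero_mult_div_cancel_left less_trans less_irrefl)
  qed
  consider "s < t" | "t < s" | "s = t"
    by linarith
  then show ?thesis
  proof cases
    case 1
    have "f t \<le> f s / s * t"
      using ratio[OF st(1) 1] st by (simp add: divide_le_eq)
    moreover have "f s / s * s = f s"
      using st by simp
    ultimately show ?thesis
      using mono[OF st(1) 1] 1 by (simp add: right_diff_distrib)
  next
    case 2
    have "f s / s * t \<le> f t"
      using ratio[OF st(2) 2] st by (simp add: le_divide_eq)
    moreover have "f s / s * s = f s"
      using st by simp
    ultimately show ?thesis
      using mono[OF st(2) 2] 2 by (simp add: right_diff_distrib)
  qed simp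
qed

lemma isCont_of_symmetric_mono:
  fixes f :: "real \<Rightarrow> real"
  assumes "\<And>s t. 0 < s \<Longrightarrow> s < t \<Longrightarrow> f s \<le> f t" "\<And>t. t > 0 \<Longrightarrow> t * f (1 / t) = f t" "0 < s"
  shows "isCont f s"
proof -
  have "((\<lambda>t. f t - f s) \<longlongrightarrow> 0) (at s)"
  proof (rule tendsto_0_le)
    show "((\<lambda>t. t - s) \<longlongrightarrow> 0) (at s)"
      by (auto intro!: tendsto_eq_intros)
    have "\<forall>\<^sub>F t in at s. t > 0"
      using order_tendstoD(1)[OF tendsto_ident_at[of s UNIV], of 0] assms(3) by simp
    then show "\<forall>\<^sub>F t in at s. norm (f t - f s) \<le> norm (t - s) * (f s / s)"
      by eventually_elim
        (use abs_diff_le_of_symmetric_mono[OF assms(1,2,3)] in \<open>simp add: mult.commute\<close>)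
  qed
  then show ?thesis
    by (simp add: isCont_def LIM_zero_iff)
qed

text \<open>Used to let \<open>\<epsilon>\<close> tend to 0 in \<open>slope_equation\<close>. If
  trace and determinant converge to those of the diagonal matrix with entries \<open>a\<close> and
  \<open>b\<close>, the eigenvalues converge to \<open>a\<close> and \<open>b\<close>, and the
  denominator has the nonzero limit \<open>a - b\<close>.\<close>

lemma tendsto_slope_roots:
  assumes \<tau>: "(\<tau> \<longlongrightarrow> a + b) F" and D: "(D \<longlongrightarrow> a * b) F"
    and ab: "b < a" and cont: "isCont \<phi> a" "isCont \<phi> b"
  shows "((\<lambda>x. slope \<phi> (hi_root (\<tau> x) (D x)) (lo_root (\<tau> x) (D x))) \<longlongrightarrow> slope \<phi> a b) F"
proof -
  have hi: "((\<lambda>x. hi_root (\<tau> x) (D x)) \<longlongrightarrow> a) F"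
  proof -
    have "((\<lambda>x. hi_root (\<tau> x) (D x)) \<longlongrightarrow> hi_root (a + b) (a * b)) F"
      unfolding hi_root_def by (intro tendsto_intros \<tau> D) simp
    then show ?thesis
      using roots_of_product(1)[of b a] ab by simp
  qed
  have lo: "((\<lambda>x. lo_root (\<tau> x) (D x)) \<longlongrightarrow> b) F"
  proof -
    have "((\<lambda>x. lo_root (\<tau> x) (D x)) \<longlongrightarrow> lo_root (a + b) (a * b)) F"
      unfolding lo_root_def by (intro tendsto_intros \<tau> D) simp
    then show ?thesis
      using roots_of_product(2)[of b a] ab by simp
  qed
  show ?thesis
    unfolding slope_def
    by (intro tendsto_intros hi lo isCont_tendsto_compose[OF cont(1) hi] isCont_tendsto_compose[OF cont(2) lo])
      (use ab in simp)
qed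

section \<open>Consequences of the associativity hypothesis for block operators\<close>

context orthonormal_pair
begin

context
  fixes f g :: "real \<Rightarrow> real"
  assumes f_pos: "\<And>t. t > 0 \<Longrightarrow> f t > 0" and f_mono: "strict_mono_on {0<..} f"
    and f_symm: "\<forall>t>0. t * f (1 / t) = f t"
    and g_pos: "\<And>t. t > 0 \<Longrightarrow> g t > 0" and g_mono: "strict_mono_on {0<..} g"
    and assoc: "\<forall>A B :: 'a \<Rightarrow> 'a. pos_def_op A \<and> pos_def_op B \<longrightarrow>
        fc g (km_mean f (fc g (km_mean f A id)) B) = fc g (km_mean f A (fc g (km_mean f id B)))"
begin

abbreviation (input) h :: "real \<Rightarrow> real" where "h t \<equiv> g (f t)"

text \<open>The hypothesis for the scalar operators \<open>x\<close> and \<open>y\<close> times the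
  identity, with the injective \<open>g\<close> cancelled.\<close>

lemma scalar_equation:
  assumes "x > 0" "y > 0"
  shows "h x * f (y / h x) = x * f (h y / x)"
proof -
  have h: "h x > 0" "h y > 0"
    using assms f_pos g_pos by auto
  have "pos_def_op (block x 0 0 x x)" "pos_def_op (block y 0 0 y y)"
    using assms by (auto intro: pos_def_block)
  then have "fc g (km_mean f (fc g (km_mean f (block x 0 0 x x) id)) (block y 0 0 y y))
      = fc g (km_mean f (block x 0 0 x x) (fc g (km_mean f id (block y 0 0 y y))))"
    using assoc by blast
  then have "g (h x * f (y / h x)) = g (x * f (h y / x))"
    unfolding km_mean_id[OF assms(1,1,1) f_symm] id_km_mean fc_block_diag
      km_mean_diag[OF h(1) h(1) h(1)] km_mean_diag[OF assms(1,1,1)]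
    by (rule block_entries_eq)
  then show ?thesis
    using inj_onD[OF strict_mono_on_imp_inj_on[OF g_mono]] assms h f_pos by simp
qed

text \<open>The hypothesis for \<open>?A\<close> and \<open>?B\<close> below. The eigenvalues of
  \<open>?B\<close> on the span are \<open>1 + \<epsilon>\<close> and \<open>1 - \<epsilon>\<close>,
  so applying \<open>h\<close> scales its off-diagonal entry by the slope of \<open>h\<close>
  between them. Each side of the claim is the off-diagonal entry of one mean, divided by
  \<open>\<epsilon>\<close>.\<close>

lemma slope_equation:
  assumes xy: "x > 0" "y > 0" and \<epsilon>: "0 < \<epsilon>" "\<epsilon> < 1"
  shows "slope f (hi_root (1 / h x + 1 / h y) ((1 - \<epsilon> * \<epsilon>) / (h x * h y)))
      (lo_root (1 / h x + 1 / h y) ((1 - \<epsilon> * \<epsilon>) / (h x * h y)))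
    = slope f
        (hi_root ((h (1 + \<epsilon>) + h (1 - \<epsilon>)) / 2 / x + (h (1 + \<epsilon>) + h (1 - \<epsilon>)) / 2 / y) (h (1 + \<epsilon>) * h (1 - \<epsilon>) / (x * y)))
        (lo_root ((h (1 + \<epsilon>) + h (1 - \<epsilon>)) / 2 / x + (h (1 + \<epsilon>) + h (1 - \<epsilon>)) / 2 / y) (h (1 + \<epsilon>) * h (1 - \<epsilon>) / (x * y)))
      * slope h (1 + \<epsilon>) (1 - \<epsilon>)" (is "?L = ?R * _")
proof -
  have hpos: "h t > 0" if "t > 0" for t
    using that f_pos g_pos by auto
  have one: "0 < (1::real)"
    by simp
  have g_inj: "inj_on g {0<..}"
    by (rule strict_mono_on_imp_inj_on[OF g_mono])
  define H1 H2 where "H1 = h (1 + \<epsilon>)" and "H2 = h (1 - \<epsilon>)"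
  have H: "0 < H2" "H2 < H1"
  proof -
    have "f (1 - \<epsilon>) < f (1 + \<epsilon>)"
      using strict_mono_onD[OF f_mono, of "1 - \<epsilon>" "1 + \<epsilon>"] \<epsilon> by simp
    then show "H2 < H1"
      using strict_mono_onD[OF g_mono, of "f (1 - \<epsilon>)" "f (1 + \<epsilon>)"] f_pos \<epsilon> by (simp add: H1_def H2_def)
    show "0 < H2"
      using hpos \<epsilon> by (simp add: H2_def)
  qed
  let ?A = "block x 0 0 y 1" and ?B = "block 1 \<epsilon> \<epsilon> 1 1"
  have \<epsilon>2: "\<epsilon> * \<epsilon> < 1"
    using \<epsilon> mult_strict_mono[of \<epsilon> 1 \<epsilon> 1] by simp
  have "pos_def_op ?A" "pos_def_op ?B"
    using xy \<epsilon>2 by (auto intro: pos_def_block)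
  then have eq: "fc g (km_mean f (fc g (km_mean f ?A id)) ?B) = fc g (km_mean f ?A (fc g (km_mean f id ?B)))"
    using assoc by blast
  have hA: "fc g (km_mean f ?A id) = block (h x) 0 0 (h y) (h 1)"
    unfolding km_mean_id[OF xy one f_symm] fc_block_diag ..
  define k where "k = slope h (1 + \<epsilon>) (1 - \<epsilon>)"
  have k: "k = (H1 - H2) / (2 * \<epsilon>)" "k > 0" "k * \<epsilon> = (H1 - H2) / 2"
    using H \<epsilon> by (simp_all add: k_def slope_def H1_def H2_def)
  have hB: "fc g (km_mean f id ?B) = block ((H1 + H2) / 2) (k * \<epsilon>) (k * \<epsilon>) ((H1 + H2) / 2) (h 1)"
  proof -
    have l: "1 + \<epsilon> \<noteq> 1 - \<epsilon>" "(1 + \<epsilon>) + (1 - \<epsilon>) = 1 + 1" "(1 + \<epsilon>) * (1 - \<epsilon>) = 1 * 1 - \<epsilon> * \<epsilon>"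
      using \<epsilon> by (simp_all add: algebra_simps)
    have ne: "f (1 + \<epsilon>) \<noteq> f (1 - \<epsilon>)"
      using H by (auto simp: H1_def H2_def)
    have "fc g (km_mean f id ?B) = fc (\<lambda>t. h t) ?B"
      unfolding id_km_mean by (rule fc_fc_block[OF l ne])
    also have "\<dots> = block (H2 + k * (1 - (1 - \<epsilon>))) (k * \<epsilon>) (k * \<epsilon>) (H2 + k * (1 - (1 - \<epsilon>))) (h 1)"
      unfolding H2_def k_def slope_def by (rule fc_block[OF l])
    also have "H2 + k * (1 - (1 - \<epsilon>)) = (H1 + H2) / 2"
      using k(3) by (simp add: field_simps)
    finally show ?thesis .
  qed
  have det: "(H1 + H2) / 2 * ((H1 + H2) / 2) - k * \<epsilon> * (k * \<epsilon>) = H1 * H2"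
    unfolding k(3) by (simp add: field_simps)
  moreover have "0 < H1 * H2"
    using H by simp
  ultimately have det_pos: "k * \<epsilon> * (k * \<epsilon>) < (H1 + H2) / 2 * ((H1 + H2) / 2)"
    by linarith
  have pdB: "0 < (1::real)" "0 < (1::real)" "\<epsilon> \<noteq> 0" "\<epsilon> * \<epsilon> < 1 * 1" "0 < (1::real)"
    using \<epsilon> \<epsilon>2 by simp_all
  have pdhB: "0 < (H1 + H2) / 2" "0 < (H1 + H2) / 2" "k * \<epsilon> \<noteq> 0"
    "k * \<epsilon> * (k * \<epsilon>) < (H1 + H2) / 2 * ((H1 + H2) / 2)" "0 < h 1"
    using H k \<epsilon> det_pos hpos by simp_all
  have h3: "0 < h x" "0 < h y" "0 < h 1"
    using hpos xy by simp_all
  obtain P S V where L: "km_mean f (block (h x) 0 0 (h y) (h 1)) ?B = block P (?L * \<epsilon>) (?L * \<epsilon>) S V"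
    "P > 0" "S > 0" "V > 0" "(?L * \<epsilon>) * (?L * \<epsilon>) < P * S" "?L > 0"
    using km_mean_offdiag[OF h3 pdB f_mono f_pos, unfolded mult_1_left] by metis
  obtain P' S' V' where R: "km_mean f ?A (block ((H1 + H2) / 2) (k * \<epsilon>) (k * \<epsilon>) ((H1 + H2) / 2) (h 1))
      = block P' (?R * (k * \<epsilon>)) (?R * (k * \<epsilon>)) S' V'"
    "P' > 0" "S' > 0" "V' > 0" "(?R * (k * \<epsilon>)) * (?R * (k * \<epsilon>)) < P' * S'" "?R > 0"
    using km_mean_offdiag[OF xy one pdhB f_mono f_pos, unfolded det] unfolding H1_def H2_def by metis
  \<comment> \<open>Both means have nonzero off-diagonal entries, so \<open>fc_block_inj\<close> can
    remove the outer \<open>g\<close>.\<close>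
  have "?L * \<epsilon> > 0" "?R * (k * \<epsilon>) > 0"
    by (rule mult_pos_pos[OF L(6) \<epsilon>(1)], rule mult_pos_pos[OF R(6) mult_pos_pos[OF k(2) \<epsilon>(1)]])
  then have "?L * \<epsilon> \<noteq> 0" "?R * (k * \<epsilon>) \<noteq> 0"
    by (metis less_irrefl)+
  then have "block P (?L * \<epsilon>) (?L * \<epsilon>) S V = block P' (?R * (k * \<epsilon>)) (?R * (k * \<epsilon>)) S' V'"
    using fc_block_inj[OF L(2,3) _ L(5,4) R(2,3) _ R(5,4) g_inj] eq unfolding hA hB L(1) R(1) by blast
  then have "?L * \<epsilon> = ?R * (k * \<epsilon>)"
    by (rule block_entries_eq)
  then have "?L * \<epsilon> = (?R * k) * \<epsilon>"
    by simp
  then show ?thesis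
    unfolding k_def[symmetric] using \<epsilon> by (simp only: mult_cancel_right) simp
qed

end

end

theorem theorem6:
  fixes f g :: "real \<Rightarrow> real"
  assumes dimH: "\<not> (\<exists>v::'a::chilbert. \<forall>x::'a. \<exists>c. x = c *\<^sub>C v)"
    and f_pos: "\<forall>t>0. f t > 0"
    and f_one: "f 1 = 1"
    and f_opmono: "operator_monotone f"
    and f_symm: "\<forall>t>0. t * f (1 / t) = f t"
    and g_cont: "continuous_on {0<..} g"
    and g_mono: "strict_mono_on {0<..} g"
    and g_surj: "g ` {0<..} = {0<..}"
    and assoc: "\<forall>A B :: 'a \<Rightarrow> 'a. pos_def_op A \<and> pos_def_op B \<longrightarrow>
        fc g (km_mean f (fc g (km_mean f A id)) B) = fc g (km_mean f A (fc g (km_mean f id B)))"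
  shows "(\<forall>t>0. g (f t) = t)
    \<or> (\<exists>c>0. c \<noteq> 1 \<and> (\<forall>t>0. f (c\<^sup>2 * t) = c * f t))
    \<or> (\<forall>t>0. f t = (1 + t) / 2)
    \<or> (\<forall>t>0. f t = 2 * t / (1 + t))"
proof -
  obtain e1 e2 :: 'a where "orthonormal_pair e1 e2"
    using orthonormal_pair_exists[OF dimH] by blast
  then interpret orthonormal_pair e1 e2 .
  have fp: "f t > 0" if "t > 0" for t
    using f_pos that by simp
  have gp: "g t > 0" if "t > 0" for t
    using g_surj that by auto
  have fs: "t * f (1 / t) = f t" if "t > 0" for t
    using f_symm that by simp
  \<comment> \<open>Symmetry gives \<open>f 2 = 2 * f (1 / 2)\<close>, so \<open>f\<close> is not
    constant.\<close>
  have "f 2 \<noteq> f (1 / 2)"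
    using fs[of 2] fp[of 2] by auto
  then have f_mono: "strict_mono_on {0<..} f"
    using operator_monotone_strict[OF f_opmono, of 2 "1 / 2"] by simp
  define h where "h = (\<lambda>t. g (f t))"
  have h_pos: "h t > 0" if "t > 0" for t
    using that fp gp by (simp add: h_def)
  have h_mono: "h s < h t" if "0 < s" "s < t" for s t
  proof -
    have "f s < f t"
      using strict_mono_onD[OF f_mono, of s t] that by simp
    then show ?thesis
      using strict_mono_onD[OF g_mono, of "f s" "f t"] fp that by (simp add: h_def)
  qed
  have f_cont: "isCont f t" if "t > 0" for t
    using isCont_of_symmetric_mono[OF operator_monotone_mono[OF f_opmono] fs that] .
  have h_cont: "isCont h 1"
    unfolding h_def
  proof (rule isCont_o2[OF f_cont])
    show "isCont g (f 1)"
      using g_cont f_one by (simp add: continuous_on_eq_continuous_at)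
  qed simp
  define d where "d = h 1"
  have d: "d > 0"
    using h_pos by (simp add: d_def)
  define \<kappa> where "\<kappa> = (\<lambda>x y. slope f (1 / h x) (1 / h y) / slope f (d / x) (d / y))"
  have slope_pos: "slope f a b > 0" if "0 < b" "b < a" for a b
    using strict_mono_onD[OF f_mono, of b a] that by (simp add: slope_def)
  \<comment> \<open>Differentiability of \<open>h\<close> at 1 is not presupposed: the symmetric
    difference quotient converges because it is a quotient of two convergent slopes of
    \<open>f\<close>.\<close>
  have lim: "((\<lambda>\<epsilon>. slope h (1 + \<epsilon>) (1 - \<epsilon>)) \<longlongrightarrow> \<kappa> x y) (at_right 0)"
    if xy: "0 < x" "x < y" for x y
  proof -
    have y: "0 < y" and hx: "0 < h x" "0 < h y" "h x < h y"
      using xy h_pos h_mono by auto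
    have h1: "((\<lambda>\<epsilon>. h (1 + \<epsilon>)) \<longlongrightarrow> d) (at_right 0)" "((\<lambda>\<epsilon>. h (1 - \<epsilon>)) \<longlongrightarrow> d) (at_right 0)"
      unfolding d_def by (auto intro!: isCont_tendsto_compose[OF h_cont] tendsto_eq_intros)
    let ?L = "\<lambda>\<epsilon>. slope f (hi_root (1 / h x + 1 / h y) ((1 - \<epsilon> * \<epsilon>) / (h x * h y)))
        (lo_root (1 / h x + 1 / h y) ((1 - \<epsilon> * \<epsilon>) / (h x * h y)))"
    let ?\<tau> = "\<lambda>\<epsilon>. (h (1 + \<epsilon>) + h (1 - \<epsilon>)) / 2 / x + (h (1 + \<epsilon>) + h (1 - \<epsilon>)) / 2 / y"
    let ?D = "\<lambda>\<epsilon>. h (1 + \<epsilon>) * h (1 - \<epsilon>) / (x * y)"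
    let ?R = "\<lambda>\<epsilon>. slope f (hi_root (?\<tau> \<epsilon>) (?D \<epsilon>)) (lo_root (?\<tau> \<epsilon>) (?D \<epsilon>))"
    have L: "(?L \<longlongrightarrow> slope f (1 / h x) (1 / h y)) (at_right 0)"
    proof (rule tendsto_slope_roots)
      show "((\<lambda>\<epsilon>. (1 - \<epsilon> * \<epsilon>) / (h x * h y)) \<longlongrightarrow> 1 / h x * (1 / h y)) (at_right 0)"
        using hx by (auto intro!: tendsto_eq_intros)
      show "1 / h y < 1 / h x"
        using hx by (simp add: frac_less2)
    qed (use hx in \<open>auto intro!: f_cont\<close>)
    have R: "(?R \<longlongrightarrow> slope f (d / x) (d / y)) (at_right 0)"
    proof (rule tendsto_slope_roots)
      show "(?\<tau> \<longlongrightarrow> d / x + d / y) (at_right 0)"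
        using xy y by (auto intro!: tendsto_eq_intros h1)
      show "(?D \<longlongrightarrow> d / x * (d / y)) (at_right 0)"
        using xy y by (auto intro!: tendsto_eq_intros h1)
      show "d / y < d / x"
        using xy d by (simp add: frac_less2)
    qed (use xy y d in \<open>auto intro!: f_cont\<close>)
    have R0: "slope f (d / x) (d / y) > 0"
      using xy y d by (intro slope_pos) (auto simp: frac_less2)
    have "((\<lambda>\<epsilon>. ?L \<epsilon> / ?R \<epsilon>) \<longlongrightarrow> \<kappa> x y) (at_right 0)"
      unfolding \<kappa>_def by (intro tendsto_divide L R) (use R0 in simp)
    moreover have "\<forall>\<^sub>F \<epsilon> in at_right 0. ?L \<epsilon> / ?R \<epsilon> = slope h (1 + \<epsilon>) (1 - \<epsilon>)"
    proof -
      have "\<forall>\<^sub>F \<epsilon> in at_right (0::real). 0 < \<epsilon> \<and> \<epsilon> < 1"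
        unfolding eventually_at_right_field by (intro exI[of _ 1]) auto
      moreover have "\<forall>\<^sub>F \<epsilon> in at_right 0. ?R \<epsilon> > 0"
        by (rule order_tendstoD(1)[OF R R0])
      ultimately show ?thesis
      proof eventually_elim
        case (elim \<epsilon>)
        then have "?L \<epsilon> = ?R \<epsilon> * slope h (1 + \<epsilon>) (1 - \<epsilon>)"
          unfolding h_def by (intro slope_equation[OF fp f_mono f_symm gp g_mono assoc xy(1) y]) auto
        then show ?case
          using elim by simp
      qed
    qed
    ultimately show ?thesis
      by (rule Lim_transform_eventually)
  qed
  define K where "K = \<kappa> 1 2"
  \<comment> \<open>The difference quotient of \<open>h\<close> does not involve \<open>x\<close>
    and \<open>y\<close>, so by uniqueness of limits all the values \<open>\<kappa> x y\<close>
    agree.\<close>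
  have \<kappa>: "\<kappa> x y = K" if "0 < x" "x < y" for x y
    unfolding K_def by (rule tendsto_unique[OF _ lim[OF that] lim]) auto
  have "K > 0"
    unfolding K_def \<kappa>_def using d h_pos h_mono[of 1 2]
    by (intro divide_pos_pos slope_pos) (auto simp: frac_less2)
  have "(\<forall>t>0. h t = t) \<or> (\<exists>c>0. c \<noteq> 1 \<and> (\<forall>t>0. f (c\<^sup>2 * t) = c * f t))
    \<or> (\<forall>t>0. f t = (1 + t) / 2) \<or> (\<forall>t>0. f t = 2 * t / (1 + t))"
  proof (rule mean_function_classification[where K = K])
    show "inj_on f {0<..}"
      by (rule strict_mono_on_imp_inj_on[OF f_mono])
    show "inj_on h {0<..}"
      using h_mono by (intro strict_mono_on_imp_inj_on strict_mono_onI) auto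
    show "h x * f (y / h x) = x * f (h y / x)" if "x > 0" "y > 0" for x y
      unfolding h_def by (rule scalar_equation[OF fp f_mono f_symm gp g_mono assoc that])
    show "K * ((f (h 1 / x) - f (h 1 / y)) / (h 1 / x - h 1 / y))
        = (f (1 / h x) - f (1 / h y)) / (1 / h x - 1 / h y)" if "0 < x" "x < y" for x y
    proof -
      have "slope f (d / x) (d / y) > 0"
        using that d by (intro slope_pos) (auto simp: frac_less2)
      then have "K * slope f (d / x) (d / y) = slope f (1 / h x) (1 / h y)"
        unfolding \<kappa>[OF that, symmetric] \<kappa>_def by simp
      then show ?thesis
        by (simp add: slope_def d_def)
    qed
  qed (use fp fs f_one h_pos \<open>K > 0\<close> in auto)
  then show ?thesis
    by (simp add: h_def)
qed

end
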